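(* Let $T>0$, let $(B_t)_{0\le t\le T}$ be a standard $n$-dimensional Brownian motion and let $X=(X_1,\dots,X_m)^T$ be a centered Gaussian random vector in $\mathbb{R}^m$ with covariance $\Sigma\in\mathbb{R}^{m\times m}$, such that the family $\{X,B_t;\,0\le t\le T\}$ is jointly Gaussian and $\mathbb{E}[B_tX^T]=\rho(t)$ for $0\le t\le T$, where $\rho\in C^2([0,T];\mathbb{R}^{n\times m})$. Let $g\in C([0,T];\mathbb{R}^{n\times m})$ be a function such that $$g'(t)\Big(\Sigma-\int_0^t\rho'(u)^T\rho'(u)\,du\Big)=\rho'(t),\qquad g(0)=0,\qquad t\in[0,T].$$ Let $\lambda(t,s)=g(t)p(s)+q(s)$ for $0\le s\le t\le T$, where $p\in C([0,T];\mathbb{R}^{m\times n})$ and $q\in C([0,T];\mathbb{R}^{n\times n})$ are given by $$p(s)=\rho''(s)^T,\qquad q(s)=-g(s)\rho''(s)^T-g'(s)\rho'(s)^T .$$ Then the process $$\tilde B_t=B_t-\int_0^t\lambda(t,u)B_u\,du-g(t)X,\qquad 0\le t\le T,$$ is an $n$-dimensional $(\mathcal{G}_t)$-Brownian motion, where $(\mathcal{G}_t)_{0\le t\le T}$ is the augmented filtration of $\sigma(X,B_s;\,0\le s\le t)$.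
   Context: All random objects live on a complete probability space $(\Omega,\mathcal{F},\mathbb{P})$. Primes denote derivatives in the time variable and the superscript $T$ denotes matrix transpose. "Augmented" means completed with the $\mathbb{P}$-null sets. *)

theory Defs
  imports "HOL-Probability.Probability"
begin

text \<open>
  The one-dimensional normal law with mean \<open>\<mu>\<close> and variance \<open>v \<ge> 0\<close>. The degenerate case
  is treated separately because \<^const>\<open>normal_density\<close> (which takes the standard deviation)
  is identically 0 for standard deviation 0.
\<close>

definition normal_law :: "real \<Rightarrow> real \<Rightarrow> real measure" where
  "normal_law \<mu> v =
     (if v = 0 then return borel \<mu> else density lborel (\<lambda>x. ennreal (normal_density \<mu> (sqrt v) x)))"

definition gaussian_rv :: "'w measure \<Rightarrow> ('w \<Rightarrow> real) \<Rightarrow> bool" where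
  "gaussian_rv M Y \<longleftrightarrow>
     Y \<in> borel_measurable M \<and> (\<exists>\<mu> v. 0 \<le> v \<and> distr M borel Y = normal_law \<mu> v)"

definition jointly_gaussian :: "'w measure \<Rightarrow> 'i set \<Rightarrow> ('i \<Rightarrow> 'w \<Rightarrow> real) \<Rightarrow> bool" where
  "jointly_gaussian M I Y \<longleftrightarrow>
     (\<forall>J c. finite J \<and> J \<subseteq> I \<longrightarrow> gaussian_rv M (\<lambda>\<omega>. \<Sum>j\<in>J. c j * Y j \<omega>))"

definition gaussian_vector :: "'w measure \<Rightarrow> ('w \<Rightarrow> real ^ 'd) \<Rightarrow> bool" where
  "gaussian_vector M X \<longleftrightarrow> jointly_gaussian M UNIV (\<lambda>i \<omega>. X \<omega> $ i)"

definition covariance_matrix :: "'w measure \<Rightarrow> ('w \<Rightarrow> real ^ 'd) \<Rightarrow> real ^ 'd ^ 'd" where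
  "covariance_matrix M X =
     (\<chi> i j. LINT \<omega>|M. (X \<omega> $ i - (LINT \<omega>'|M. X \<omega>' $ i)) * (X \<omega> $ j - (LINT \<omega>'|M. X \<omega>' $ j)))"

definition centered_gaussian_vector ::
  "'w measure \<Rightarrow> ('w \<Rightarrow> real ^ 'd) \<Rightarrow> real ^ 'd ^ 'd \<Rightarrow> bool" where
  "centered_gaussian_vector M X C \<longleftrightarrow>
     gaussian_vector M X \<and> (\<forall>i. (LINT \<omega>|M. X \<omega> $ i) = 0) \<and> covariance_matrix M X = C"

text \<open>The rank-one matrix \<open>x y\<^sup>T\<close>.\<close>

definition outer_product :: "real ^ 'a \<Rightarrow> real ^ 'b \<Rightarrow> real ^ 'b ^ 'a" where
  "outer_product x y = (\<chi> i j. x $ i * y $ j)"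

text \<open>
  The vector \<open>X\<close> and the vectors \<open>B\<^sub>t\<close> have different dimensions, so the family
  \<open>{X, B\<^sub>t; 0 \<le> t \<le> T}\<close> is represented by all its scalar components:
  \<open>Inl i\<close> stands for \<open>X\<^sub>i\<close> and \<open>Inr (t, k)\<close> for the \<open>k\<close>-th component of \<open>B\<^sub>t\<close>.
\<close>

definition component_family ::
  "('w \<Rightarrow> real ^ 'm) \<Rightarrow> (real \<Rightarrow> 'w \<Rightarrow> real ^ 'n) \<Rightarrow> 'm + real \<times> 'n \<Rightarrow> 'w \<Rightarrow> real" where
  "component_family X B j \<omega> = (case j of Inl i \<Rightarrow> X \<omega> $ i | Inr (t, k) \<Rightarrow> B t \<omega> $ k)"

definition natural_filtration ::
  "'w measure \<Rightarrow> (real \<Rightarrow> 'w \<Rightarrow> real ^ 'n) \<Rightarrow> real \<Rightarrow> 'w measure" where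
  "natural_filtration M W t =
     sigma (space M) (\<Union>s\<in>{0..t}. {W s -` A \<inter> space M | A. A \<in> sets borel})"

text \<open>The filtration \<open>\<sigma>(X, B\<^sub>s; 0 \<le> s \<le> t)\<close>.\<close>

definition enlarged_filtration ::
  "'w measure \<Rightarrow> ('w \<Rightarrow> real ^ 'm) \<Rightarrow> (real \<Rightarrow> 'w \<Rightarrow> real ^ 'n) \<Rightarrow> real \<Rightarrow> 'w measure" where
  "enlarged_filtration M X B t =
     sigma (space M) ({X -` A \<inter> space M | A. A \<in> sets borel} \<union>
                      (\<Union>s\<in>{0..t}. {B s -` A \<inter> space M | A. A \<in> sets borel}))"

definition augmented :: "'w measure \<Rightarrow> (real \<Rightarrow> 'w measure) \<Rightarrow> real \<Rightarrow> 'w measure" where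
  "augmented M F t = sigma (space M) (sets (F t) \<union> null_sets M)"

text \<open>
  Brownian motion on \<open>[0, T]\<close> with respect to a filtration \<open>F\<close>, started at 0 and with
  continuous paths almost surely. Only the values at times in \<open>[0, T]\<close> are constrained.
\<close>

definition brownian_motion_wrt ::
  "'w measure \<Rightarrow> real \<Rightarrow> (real \<Rightarrow> 'w measure) \<Rightarrow> (real \<Rightarrow> 'w \<Rightarrow> real ^ 'n) \<Rightarrow> bool" where
  "brownian_motion_wrt M T F W \<longleftrightarrow>
     (\<forall>t\<in>{0..T}. subalgebra M (F t)) \<and>
     (\<forall>s t. 0 \<le> s \<and> s \<le> t \<and> t \<le> T \<longrightarrow> sets (F s) \<subseteq> sets (F t)) \<and>
     (\<forall>t\<in>{0..T}. W t \<in> borel_measurable (F t)) \<and>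
     (AE \<omega> in M. W 0 \<omega> = 0) \<and>
     (AE \<omega> in M. continuous_on {0..T} (\<lambda>t. W t \<omega>)) \<and>
     (\<forall>s t. 0 \<le> s \<and> s < t \<and> t \<le> T \<longrightarrow>
        prob_space.indep_set M (sets (F s))
          {(\<lambda>\<omega>. W t \<omega> - W s \<omega>) -` A \<inter> space M | A. A \<in> sets borel} \<and>
        centered_gaussian_vector M (\<lambda>\<omega>. W t \<omega> - W s \<omega>) ((t - s) *\<^sub>R mat 1))"

definition standard_brownian_motion ::
  "'w measure \<Rightarrow> real \<Rightarrow> (real \<Rightarrow> 'w \<Rightarrow> real ^ 'n) \<Rightarrow> bool" where
  "standard_brownian_motion M T W \<longleftrightarrow> brownian_motion_wrt M T (natural_filtration M W) W"

end

(*  The family {X, B_t} lies in a space of centered Gaussian variables closed under the almost sure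
    limits that occur, so independence reduces to vanishing covariances, and covariances with the
    integral in the definition of the process are integrals of covariances.

    The kernel is a derivative, lambda(t,u) = d/du ((g(t) - g(u)) rho'(u)^T). Write W for the process
    and Gamma(t) = Sigma - int_0^t rho'^T rho'. Integration by parts turns E[W_t X^T] into
    rho(t) - int_0^t g rho'^T rho' - g(t) Gamma(t), which vanishes because its derivative
    rho' - g' Gamma does, and E[W_t B_r^T] for r <= t into psi(r) = r I - int_0^r g rho'^T, which does
    not depend on t. So W_t - W_s is orthogonal to X and to B_r for r <= s. Using g' Gamma = rho'
    again, E[W_s W_t^T] = s I for s <= t. *)

theory Submission
  imports Defs
begin

subsection \<open>Deterministic matrix identities\<close>

text \<open>The passage from B and X to W is linear with deterministic coefficients, so on
  covariances it acts through a deterministic operator \<open>L\<close>, and the theorem comes down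
  to three evaluations of \<open>L\<close>: at the covariances of B with X, with a fixed B_r, and
  with W itself.

  Two obstacles shape the rest. \<open>\<Gamma>\<close> may be singular and g' may be discontinuous,
  so g' is neither solved for nor integrated alone: it enters only through
  \<open>g' ** \<Gamma>\<close>, which is \<rho>', and through g' times the transpose of \<rho>',
  whose continuity is inherited from q. Moreover, the drift is an integral along paths that are
  continuous only almost surely, and joint measurability is not among the data. It is therefore
  treated as an almost sure limit of Riemann sums. Almost sure limits of centered normal variables
  are centered normal with convergent variances, which gives both the Gaussian law of the drift and
  the exchange of expectation and integral. Independence is read off from factorising characteristic
  functions, which covers degenerate Gaussian laws as well.\<close>

lemma bounded_bilinear_matrix_matrix_mult:
  "bounded_bilinear ((**) :: real^'b^'a \<Rightarrow> real^'c^'b \<Rightarrow> real^'c^'a)"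
proof -
  have "bilinear ((**) :: real^'b^'a \<Rightarrow> real^'c^'b \<Rightarrow> real^'c^'a)"
    unfolding bilinear_def
    by (auto intro!: linearI simp: matrix_matrix_mult_def vec_eq_iff sum.distrib sum_distrib_left
        algebra_simps)
  then show ?thesis
    by (simp add: bilinear_conv_bounded_bilinear)
qed

lemma bounded_bilinear_matrix_vector_mult:
  "bounded_bilinear ((*v) :: real^'b^'a \<Rightarrow> real^'b \<Rightarrow> real^'a)"
proof -
  have "bilinear ((*v) :: real^'b^'a \<Rightarrow> real^'b \<Rightarrow> real^'a)"
    unfolding bilinear_def
    by (auto intro!: linearI simp: matrix_vector_mult_def vec_eq_iff sum.distrib sum_distrib_left
        algebra_simps)
  then show ?thesis
    by (simp add: bilinear_conv_bounded_bilinear)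
qed

lemma bounded_linear_transpose: "bounded_linear (transpose :: real^'b^'a \<Rightarrow> real^'a^'b)"
  by (auto intro!: linearI simp: transpose_def vec_eq_iff simp flip: linear_conv_bounded_linear)

lemmas has_vector_derivative_matrix_mult =
  bounded_bilinear.has_vector_derivative[OF bounded_bilinear_matrix_matrix_mult]
lemmas continuous_on_matrix_mult [continuous_intros] =
  bounded_bilinear.continuous_on[OF bounded_bilinear_matrix_matrix_mult]
lemmas has_vector_derivative_transpose =
  bounded_linear.has_vector_derivative[OF bounded_linear_transpose]
lemmas continuous_on_transpose [continuous_intros] =
  bounded_linear.continuous_on[OF bounded_linear_transpose]

lemmas matrix_mult_diff_right = bounded_bilinear.diff_right[OF bounded_bilinear_matrix_matrix_mult]
lemmas matrix_mult_diff_left = bounded_bilinear.diff_left[OF bounded_bilinear_matrix_matrix_mult]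
lemmas matrix_mult_minus_right = bounded_bilinear.minus_right[OF bounded_bilinear_matrix_matrix_mult]
lemmas matrix_mult_minus_left = bounded_bilinear.minus_left[OF bounded_bilinear_matrix_matrix_mult]
lemmas matrix_mult_zero_right = bounded_bilinear.zero_right[OF bounded_bilinear_matrix_matrix_mult]
lemmas matrix_mult_zero_left = bounded_bilinear.zero_left[OF bounded_bilinear_matrix_matrix_mult]
lemmas transpose_diff = linear_diff[OF bounded_linear.linear[OF bounded_linear_transpose]]
lemmas transpose_scaleR = linear_scale[OF bounded_linear.linear[OF bounded_linear_transpose]]
lemmas transpose_zero = linear_0[OF bounded_linear.linear[OF bounded_linear_transpose]]

section \<open>Calculus for the drift kernel\<close>

lemma constant_if_vector_derivative_zero:
  fixes f :: "real \<Rightarrow> 'a::real_normed_vector"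
  assumes "\<And>t. t \<in> {a..b} \<Longrightarrow> (f has_vector_derivative 0) (at t within {a..b})"
    and "t \<in> {a..b}"
  shows "f t = f a"
  using assms by (intro has_derivative_zero_unique[of "{a..b}"]) (auto simp: has_vector_derivative_def)

text \<open>The deterministic half of the argument, free of probability. Continuity is required of
  the product of g' with the transpose of \<rho>' instead of g' itself, because the product is all
  that continuity of q provides.\<close>

locale drift_kernel =
  fixes T :: real
    and \<Sigma> :: "real ^ 'm ^ 'm"
    and \<rho> \<rho>' \<rho>'' g g' :: "real \<Rightarrow> real ^ 'm ^ 'n"
  assumes \<rho>_deriv: "\<And>t. t \<in> {0..T} \<Longrightarrow> (\<rho> has_vector_derivative \<rho>' t) (at t within {0..T})"
    and \<rho>'_deriv: "\<And>t. t \<in> {0..T} \<Longrightarrow> (\<rho>' has_vector_derivative \<rho>'' t) (at t within {0..T})"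
    and g_deriv: "\<And>t. t \<in> {0..T} \<Longrightarrow> (g has_vector_derivative g' t) (at t within {0..T})"
    and \<rho>''_cont: "continuous_on {0..T} \<rho>''"
    and g'\<rho>'_cont: "continuous_on {0..T} (\<lambda>s. g' s ** transpose (\<rho>' s))"
    and g'_eq: "\<And>t. t \<in> {0..T} \<Longrightarrow>
           g' t ** (\<Sigma> - integral {0..t} (\<lambda>u. transpose (\<rho>' u) ** \<rho>' u)) = \<rho>' t"
    and \<rho>_0: "\<rho> 0 = 0" and g_0: "g 0 = 0"
    and \<Sigma>_sym: "transpose \<Sigma> = \<Sigma>"
begin

text \<open>The kernel \<open>g t ** p u + q u\<close> of the theorem, regrouped so that it is
  visibly a derivative in \<open>u\<close>.\<close>

definition kernel :: "real \<Rightarrow> real \<Rightarrow> real ^ 'n ^ 'n" where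
  "kernel t u = (g t - g u) ** transpose (\<rho>'' u) - g' u ** transpose (\<rho>' u)"

text \<open>Among the antiderivatives of \<open>kernel t\<close> this is the one that vanishes at
  \<open>u = t\<close>, so the boundary term at the upper end of the drift integral
  disappears.\<close>

definition primitive :: "real \<Rightarrow> real \<Rightarrow> real ^ 'n ^ 'n" where
  "primitive t u = (g t - g u) ** transpose (\<rho>' u)"

text \<open>If \<open>c u\<close> is the covariance of B_u with some vector U and \<open>x\<close>
  that of X with U, this is the covariance of W_t with U.\<close>

definition L :: "(real \<Rightarrow> real ^ 'd ^ 'n) \<Rightarrow> real ^ 'd ^ 'm \<Rightarrow> real \<Rightarrow> real ^ 'd ^ 'n" where
  "L c x t = c t - integral {0..t} (\<lambda>u. kernel t u ** c u) - g t ** x"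

text \<open>In the probabilistic setting, the covariance of X left over after projecting X onto B up
  to time \<open>t\<close>: the projection is the Wiener integral of the transpose of
  \<rho>'.\<close>

definition \<Gamma> :: "real \<Rightarrow> real ^ 'm ^ 'm" where
  "\<Gamma> t = \<Sigma> - integral {0..t} (\<lambda>u. transpose (\<rho>' u) ** \<rho>' u)"

text \<open>The common value at time \<open>t\<close> of the covariances of B_t with all later
  W.\<close>

definition \<psi> :: "real \<Rightarrow> real ^ 'n ^ 'n" where
  "\<psi> t = t *\<^sub>R mat 1 - integral {0..t} (\<lambda>u. g u ** transpose (\<rho>' u))"

lemma g_cont: "continuous_on {0..T} g"
  using g_deriv by (rule continuous_on_vector_derivative)

lemma \<rho>'_cont: "continuous_on {0..T} \<rho>'"
  using \<rho>'_deriv by (rule continuous_on_vector_derivative)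

lemma kernel_cont: "continuous_on {0..T} (kernel t)"
  unfolding kernel_def by (intro continuous_intros g_cont \<rho>''_cont g'\<rho>'_cont)

lemma primitive_cont: "continuous_on {0..T} (primitive t)"
  unfolding primitive_def by (intro continuous_intros g_cont \<rho>'_cont)

lemma primitive_deriv:
  assumes "u \<in> {0..T}"
  shows "(primitive t has_vector_derivative kernel t u) (at u within {0..T})"
proof -
  have "((\<lambda>u. (g t - g u) ** transpose (\<rho>' u)) has_vector_derivative
      (g t - g u) ** transpose (\<rho>'' u) + (0 - g' u) ** transpose (\<rho>' u)) (at u within {0..T})"
    using assms by (intro has_vector_derivative_matrix_mult has_vector_derivative_diff
      has_vector_derivative_const has_vector_derivative_transpose g_deriv \<rho>'_deriv)
  then show ?thesis
    by (simp add: primitive_def[abs_def] kernel_def matrix_mult_minus_left)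
qed

text \<open>Integration by parts. It is stated on an arbitrary subinterval, with derivatives taken
  within it, so that \<open>min u r\<close>, which has a kink at \<open>r\<close>, can be handled on
  each side separately.\<close>

lemma integral_kernel:
  fixes c c' :: "real \<Rightarrow> real ^ 'd ^ 'n"
  assumes "0 \<le> a" "a \<le> b" "b \<le> T"
    and c: "\<And>u. u \<in> {a..b} \<Longrightarrow> (c has_vector_derivative c' u) (at u within {a..b})"
    and c': "continuous_on {a..b} c'"
  shows "integral {a..b} (\<lambda>u. kernel t u ** c u) =
     primitive t b ** c b - primitive t a ** c a - integral {a..b} (\<lambda>u. primitive t u ** c' u)"
proof -
  have sub: "{a..b} \<subseteq> {0..T}" using assms by auto
  have c_cont: "continuous_on {a..b} c"
    using c by (rule continuous_on_vector_derivative)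
  have "((\<lambda>u. primitive t u ** c' u + kernel t u ** c u) has_integral
      (primitive t b ** c b - primitive t a ** c a)) {a..b}"
    using sub \<open>a \<le> b\<close>
    by (intro fundamental_theorem_of_calculus has_vector_derivative_matrix_mult c
        has_vector_derivative_within_subset[OF primitive_deriv]) auto
  moreover have "((\<lambda>u. primitive t u ** c' u) has_integral
      integral {a..b} (\<lambda>u. primitive t u ** c' u)) {a..b}"
    by (intro integrable_integral integrable_continuous_real continuous_intros c'
        continuous_on_subset[OF primitive_cont sub])
  ultimately have "((\<lambda>u. kernel t u ** c u) has_integral (primitive t b ** c b
      - primitive t a ** c a - integral {a..b} (\<lambda>u. primitive t u ** c' u))) {a..b}"
    by (auto dest: has_integral_diff)
  then show ?thesis by (rule integral_unique)
qed

text \<open>On the whole of \<open>{0..t}\<close> both boundary terms vanish: the upper one because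
  \<open>primitive t t = 0\<close>, the lower one because \<open>c 0 = 0\<close>. Splitting
  \<open>primitive\<close> afterwards isolates the dependence on \<open>g t\<close> as a factor in
  front of an integral.\<close>

lemma L_eq:
  fixes c c' :: "real \<Rightarrow> real ^ 'd ^ 'n"
  assumes t: "t \<in> {0..T}"
    and c: "\<And>u. u \<in> {0..T} \<Longrightarrow> (c has_vector_derivative c' u) (at u within {0..T})"
    and c': "continuous_on {0..T} c'" and "c 0 = 0"
  shows "L c x t = c t + g t ** integral {0..t} (\<lambda>u. transpose (\<rho>' u) ** c' u)
     - integral {0..t} (\<lambda>u. g u ** transpose (\<rho>' u) ** c' u) - g t ** x"
proof -
  have sub: "{0..t} \<subseteq> {0..T}" using t by auto
  have "integral {0..t} (\<lambda>u. kernel t u ** c u) = - integral {0..t} (\<lambda>u. primitive t u ** c' u)"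
    using t \<open>c 0 = 0\<close>
    by (subst integral_kernel[where c'=c'])
      (auto intro!: has_vector_derivative_within_subset[OF c, OF _ sub] continuous_on_subset[OF c' sub]
        simp: primitive_def matrix_mult_zero_right matrix_mult_zero_left)
  also have "integral {0..t} (\<lambda>u. primitive t u ** c' u)
     = integral {0..t} (\<lambda>u. g t ** (transpose (\<rho>' u) ** c' u) - g u ** transpose (\<rho>' u) ** c' u)"
    by (simp add: primitive_def matrix_mult_diff_left matrix_mul_assoc)
  also have "\<dots> = integral {0..t} (\<lambda>u. g t ** (transpose (\<rho>' u) ** c' u))
     - integral {0..t} (\<lambda>u. g u ** transpose (\<rho>' u) ** c' u)"
    by (intro integral_diff integrable_continuous_real continuous_intros
       continuous_on_subset[OF c' sub] continuous_on_subset[OF g_cont sub]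
       continuous_on_subset[OF \<rho>'_cont sub])
  also have "integral {0..t} (\<lambda>u. g t ** (transpose (\<rho>' u) ** c' u))
     = g t ** integral {0..t} (\<lambda>u. transpose (\<rho>' u) ** c' u)"
    by (subst integral_linear[unfolded o_def, OF _ bounded_bilinear.bounded_linear_right[OF
       bounded_bilinear_matrix_matrix_mult]])
     (auto intro!: integrable_continuous_real continuous_intros
       continuous_on_subset[OF c' sub] continuous_on_subset[OF \<rho>'_cont sub])
  finally show ?thesis by (simp add: L_def algebra_simps)
qed

lemma \<Gamma>_deriv:
  assumes "t \<in> {0..T}"
  shows "(\<Gamma> has_vector_derivative - (transpose (\<rho>' t) ** \<rho>' t)) (at t within {0..T})"
  unfolding \<Gamma>_def[abs_def] using assms
  by (auto intro!: derivative_eq_intros integral_has_vector_derivative continuous_intros \<rho>'_cont)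

text \<open>The equation for g' in integrated form. The derivative of \<open>\<Gamma>\<close>
  contributes exactly the negative of the integrand on the right, so what remains of the derivative
  is \<open>g' t ** \<Gamma> t - \<rho>' t\<close>; everything vanishes at 0.\<close>

lemma g_\<Gamma>:
  assumes t: "t \<in> {0..T}"
  shows "g t ** \<Gamma> t = \<rho> t - integral {0..t} (\<lambda>u. g u ** transpose (\<rho>' u) ** \<rho>' u)"
proof -
  have "g t ** \<Gamma> t - \<rho> t + integral {0..t} (\<lambda>u. g u ** transpose (\<rho>' u) ** \<rho>' u) =
      g 0 ** \<Gamma> 0 - \<rho> 0 + integral {0..0} (\<lambda>u. g u ** transpose (\<rho>' u) ** \<rho>' u)"
  proof (rule constant_if_vector_derivative_zero[OF _ t])
    fix t assume t: "t \<in> {0..T}"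
    have "(g t ** - (transpose (\<rho>' t) ** \<rho>' t) + g' t ** \<Gamma> t) - \<rho>' t
        + g t ** transpose (\<rho>' t) ** \<rho>' t = 0"
      using g'_eq[OF t] by (simp add: \<Gamma>_def matrix_mult_minus_right matrix_mul_assoc)
    moreover have "((\<lambda>t. g t ** \<Gamma> t - \<rho> t + integral {0..t} (\<lambda>u. g u ** transpose (\<rho>' u) ** \<rho>' u))
        has_vector_derivative (g t ** - (transpose (\<rho>' t) ** \<rho>' t) + g' t ** \<Gamma> t) - \<rho>' t
        + g t ** transpose (\<rho>' t) ** \<rho>' t) (at t within {0..T})"
      using t by (intro has_vector_derivative_add has_vector_derivative_diff
          has_vector_derivative_matrix_mult g_deriv \<Gamma>_deriv \<rho>_deriv
          integral_has_vector_derivative continuous_intros \<rho>'_cont g_cont)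
    ultimately show "((\<lambda>t. g t ** \<Gamma> t - \<rho> t + integral {0..t} (\<lambda>u. g u ** transpose (\<rho>' u) ** \<rho>' u))
        has_vector_derivative 0) (at t within {0..T})"
      by simp
  qed
  then show ?thesis
    by (simp add: g_0 \<rho>_0 matrix_mult_zero_left algebra_simps)
qed

lemma transpose_\<Gamma>:
  assumes "t \<in> {0..T}"
  shows "transpose (\<Gamma> t) = \<Gamma> t"
proof -
  have "transpose (integral {0..t} (\<lambda>u. transpose (\<rho>' u) ** \<rho>' u)) =
     integral {0..t} (\<lambda>u. transpose (transpose (\<rho>' u) ** \<rho>' u))"
    using assms by (subst integral_linear[unfolded o_def, OF _ bounded_linear_transpose])
     (auto intro!: integrable_continuous_real continuous_intros continuous_on_subset[OF \<rho>'_cont])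
  then show ?thesis
    by (simp add: \<Gamma>_def transpose_diff \<Sigma>_sym matrix_transpose_mul)
qed

text \<open>The integral that \<open>L_eq\<close> multiplies by \<open>g t\<close> combines with
  \<open>g t ** \<Sigma>\<close> to \<open>g t ** \<Gamma> t\<close>, and \<open>g_\<Gamma>\<close>
  applies.\<close>

lemma L_\<rho>:
  assumes t: "t \<in> {0..T}"
  shows "L \<rho> \<Sigma> t = 0"
proof -
  have "L \<rho> \<Sigma> t = \<rho> t - integral {0..t} (\<lambda>u. g u ** transpose (\<rho>' u) ** \<rho>' u) - g t ** \<Gamma> t"
    by (subst L_eq[OF t \<rho>_deriv \<rho>'_cont \<rho>_0]) (auto simp: \<Gamma>_def matrix_mult_diff_right)
  then show ?thesis by (simp add: g_\<Gamma>[OF t])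
qed

text \<open>The data are those of U = B_r. Splitting at the kink \<open>r\<close> leaves the
  boundary term \<open>primitive t r ** (r *\<^sub>R mat 1)\<close> twice with opposite signs. The
  remaining terms with \<open>g t\<close> cancel because the transpose of \<rho>' integrates over
  \<open>{0..r}\<close> to the transpose of \<open>\<rho> r\<close>, so no trace of \<open>t\<close>
  survives.\<close>

lemma L_min:
  assumes "0 \<le> r" "r \<le> t" "t \<le> T"
  shows "L (\<lambda>u. min u r *\<^sub>R mat 1) (transpose (\<rho> r)) t = \<psi> r"
proof -
  have sub: "{0..r} \<subseteq> {0..T}" "{r..t} \<subseteq> {0..T}" "{0..t} \<subseteq> {0..T}" using assms by auto
  have "integral {0..t} (\<lambda>u. kernel t u ** (min u r *\<^sub>R mat 1)) =
    integral {0..r} (\<lambda>u. kernel t u ** (min u r *\<^sub>R mat 1)) +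
    integral {r..t} (\<lambda>u. kernel t u ** (min u r *\<^sub>R mat 1))"
    using assms
    by (intro Henstock_Kurzweil_Integration.integral_combine[symmetric] integrable_continuous_real
       continuous_intros continuous_on_subset[OF kernel_cont sub(3)])
      auto
  also have "integral {0..r} (\<lambda>u. kernel t u ** (min u r *\<^sub>R mat 1)) =
     integral {0..r} (\<lambda>u. kernel t u ** (u *\<^sub>R mat 1))"
    by (intro integral_cong) auto
  also have "\<dots> = primitive t r ** (r *\<^sub>R mat 1) - integral {0..r} (\<lambda>u. primitive t u ** mat 1)"
    using assms by (subst integral_kernel[where c'="\<lambda>_. mat 1"])
      (auto intro!: derivative_eq_intros simp: matrix_mult_zero_right)
  also have "integral {r..t} (\<lambda>u. kernel t u ** (min u r *\<^sub>R mat 1)) =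
     integral {r..t} (\<lambda>u. kernel t u ** (r *\<^sub>R mat 1))"
    by (intro integral_cong) auto
  also have "\<dots> = - (primitive t r ** (r *\<^sub>R mat 1))"
    using assms by (subst integral_kernel[where c'="\<lambda>_. 0"])
      (auto intro!: derivative_eq_intros simp: matrix_mult_zero_right matrix_mult_zero_left primitive_def)
  also have "integral {0..r} (\<lambda>u. primitive t u ** mat 1) =
     integral {0..r} (\<lambda>u. g t ** transpose (\<rho>' u) - g u ** transpose (\<rho>' u))"
    by (simp add: primitive_def matrix_mult_diff_left)
  also have "\<dots> = integral {0..r} (\<lambda>u. g t ** transpose (\<rho>' u)) - integral {0..r} (\<lambda>u. g u ** transpose (\<rho>' u))"
    by (intro integral_diff integrable_continuous_real continuous_intros
       continuous_on_subset[OF g_cont sub(1)] continuous_on_subset[OF \<rho>'_cont sub(1)])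
  also have "integral {0..r} (\<lambda>u. g t ** transpose (\<rho>' u)) = g t ** transpose (\<rho> r) - g t ** transpose (\<rho> 0)"
    using assms sub
    by (intro integral_unique fundamental_theorem_of_calculus
       bounded_linear.has_vector_derivative[OF bounded_bilinear.bounded_linear_right[OF
       bounded_bilinear_matrix_matrix_mult]] has_vector_derivative_transpose
       has_vector_derivative_within_subset[OF \<rho>_deriv]) auto
  finally show ?thesis
    using assms by (simp add: L_def \<psi>_def \<rho>_0 matrix_mult_zero_right transpose_zero min_def)
qed

lemma \<psi>_deriv:
  assumes "t \<in> {0..T}"
  shows "(\<psi> has_vector_derivative mat 1 - g t ** transpose (\<rho>' t)) (at t within {0..T})"
  unfolding \<psi>_def[abs_def] using assms
  by (intro has_vector_derivative_diff integral_has_vector_derivative continuous_intros \<rho>'_cont g_cont)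
    (auto intro!: derivative_eq_intros)

lemma \<psi>_0: "\<psi> 0 = 0"
  by (simp add: \<psi>_def)

text \<open>The data are those of U = W at a later time: its covariance with B_u is the transpose of
  \<open>\<psi> u\<close>, and with X it is 0, whence the argument \<open>0\<close>.\<close>

lemma L_\<psi>:
  assumes t: "t \<in> {0..T}"
  shows "L (\<lambda>u. transpose (\<psi> u)) 0 t = t *\<^sub>R mat 1"
proof -
  let ?c' = "\<lambda>u. transpose (mat 1 - g u ** transpose (\<rho>' u)) :: real^'n^'n"
  let ?J = "\<lambda>t. integral {0..t} (\<lambda>u. transpose (\<rho>' u) ** ?c' u)"
  have L: "L (\<lambda>u. transpose (\<psi> u)) 0 t = transpose (\<psi> t) + g t ** ?J t
     - integral {0..t} (\<lambda>u. g u ** transpose (\<rho>' u) ** ?c' u)" if "t \<in> {0..T}" for t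
    by (subst L_eq[OF that, where c'="?c'"])
      (auto intro!: has_vector_derivative_transpose \<psi>_deriv continuous_intros \<rho>'_cont g_cont
        simp: \<psi>_0 matrix_mult_zero_right transpose_zero)
  \<comment> \<open>The integrand is the transpose of \<rho>' minus the integrand in
    \<open>g_\<Gamma>\<close>, so its integral is again governed by that identity.\<close>
  have J: "?J t = transpose (g t ** \<Gamma> t)" if "t \<in> {0..T}" for t
  proof -
    have sub: "{0..t} \<subseteq> {0..T}" using that by auto
    have "?J t = integral {0..t} (\<lambda>u. transpose (\<rho>' u - g u ** transpose (\<rho>' u) ** \<rho>' u))"
      by (simp add: transpose_diff matrix_mult_diff_right matrix_transpose_mul matrix_mul_assoc
          transpose_mat)
    also have "\<dots> = transpose (integral {0..t} (\<lambda>u. \<rho>' u - g u ** transpose (\<rho>' u) ** \<rho>' u))"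
      by (subst integral_linear[unfolded o_def, OF _ bounded_linear_transpose])
       (auto intro!: integrable_continuous_real continuous_intros continuous_on_subset[OF \<rho>'_cont sub]
         continuous_on_subset[OF g_cont sub])
    also have "integral {0..t} (\<lambda>u. \<rho>' u - g u ** transpose (\<rho>' u) ** \<rho>' u) =
       integral {0..t} \<rho>' - integral {0..t} (\<lambda>u. g u ** transpose (\<rho>' u) ** \<rho>' u)"
      by (intro integral_diff integrable_continuous_real continuous_intros
         continuous_on_subset[OF \<rho>'_cont sub] continuous_on_subset[OF g_cont sub])
    also have "integral {0..t} \<rho>' = \<rho> t - \<rho> 0"
      using that sub
      by (intro integral_unique fundamental_theorem_of_calculus
       has_vector_derivative_within_subset[OF \<rho>_deriv]) auto
    finally show ?thesis by (simp add: \<rho>_0 g_\<Gamma>[OF that])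
  qed
  have "transpose (\<psi> t) + g t ** ?J t
     - integral {0..t} (\<lambda>u. g u ** transpose (\<rho>' u) ** ?c' u) - t *\<^sub>R mat 1 =
     transpose (\<psi> 0) + g 0 ** ?J 0
     - integral {0..0} (\<lambda>u. g u ** transpose (\<rho>' u) ** ?c' u) - 0 *\<^sub>R mat 1"
  proof (rule constant_if_vector_derivative_zero[OF _ t])
    fix t assume t: "t \<in> {0..T}"
    let ?d = "?c' t + (g t ** (transpose (\<rho>' t) ** ?c' t) + g' t ** ?J t)
       - g t ** transpose (\<rho>' t) ** ?c' t - mat 1"
    \<comment> \<open>This is where the symmetry of \<open>\<Gamma>\<close> matters: it brings
      \<open>g' ** \<Gamma>\<close> together, giving \<rho>' times the transpose of g, which is what
      the derivative of the transposed \<open>\<psi>\<close> subtracts.\<close>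
    have "g' t ** ?J t = g' t ** \<Gamma> t ** transpose (g t)"
      using t by (simp add: J matrix_transpose_mul transpose_\<Gamma> matrix_mul_assoc)
    also have "g' t ** \<Gamma> t = \<rho>' t"
      using g'_eq[OF t] by (simp add: \<Gamma>_def)
    finally have "?d = 0"
      by (simp add: transpose_diff matrix_transpose_mul matrix_mul_assoc transpose_mat)
    moreover have "((\<lambda>t. transpose (\<psi> t) + g t ** ?J t
     - integral {0..t} (\<lambda>u. g u ** transpose (\<rho>' u) ** ?c' u) - t *\<^sub>R mat 1)
       has_vector_derivative ?d) (at t within {0..T})"
      using t by (intro has_vector_derivative_add has_vector_derivative_diff
         has_vector_derivative_matrix_mult g_deriv has_vector_derivative_transpose \<psi>_deriv
          integral_has_vector_derivative continuous_intros \<rho>'_cont g_cont)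
        (auto intro!: derivative_eq_intros)
    ultimately show "((\<lambda>t. transpose (\<psi> t) + g t ** ?J t
     - integral {0..t} (\<lambda>u. g u ** transpose (\<rho>' u) ** ?c' u) - t *\<^sub>R mat 1)
       has_vector_derivative 0) (at t within {0..T})" by simp
  qed
  then show ?thesis
    unfolding L[OF t] by (simp add: g_0 \<psi>_def transpose_zero matrix_mult_zero_left)
qed

end

subsection \<open>Centered normal variables and their limits\<close>

text \<open>The variance is an explicit argument because the limit lemma below also asserts that the
  variances converge.\<close>

definition (in prob_space) centered_normal :: "('a \<Rightarrow> real) \<Rightarrow> real \<Rightarrow> bool" where
  "centered_normal Y v \<longleftrightarrow> Y \<in> borel_measurable M \<and> 0 \<le> v \<and> distr M borel Y = normal_law 0 v"

text \<open>An affine image of the standard normal law describes the degenerate and the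
  nondegenerate case at once, so that characteristic function and moments can be computed without
  distinguishing them.\<close>

lemma normal_law_eq_distr:
  assumes "0 \<le> v"
  shows "normal_law \<mu> v = distr std_normal_distribution borel (\<lambda>x. \<mu> + sqrt v * x)"
proof (cases "v = 0")
  case True
  interpret real_distribution std_normal_distribution by (rule real_dist_normal_dist)
  have "distr std_normal_distribution borel (\<lambda>x. \<mu>) = return borel \<mu>"
    by (rule distr_const) auto
  then show ?thesis using True by (simp add: normal_law_def)
next
  case False
  then have v: "0 < sqrt v" using assms by simp
  interpret real_distribution std_normal_distribution by (rule real_dist_normal_dist)
  have "distributed std_normal_distribution lborel (\<lambda>x. x) std_normal_density"
    unfolding distributed_def by (auto simp: distr_id2)
  then have "distributed std_normal_distribution lborel (\<lambda>x. \<mu> + sqrt v * x) (normal_density \<mu> (sqrt v))"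
    using normal_density_affine[of "\<lambda>x. x" 0 1 "sqrt v" \<mu>] v by auto
  then have "distr std_normal_distribution lborel (\<lambda>x. \<mu> + sqrt v * x) = density lborel (normal_density \<mu> (sqrt v))"
    by (rule distributed_distr_eq_density)
  moreover have "distr std_normal_distribution lborel (\<lambda>x. \<mu> + sqrt v * x) =
     distr std_normal_distribution borel (\<lambda>x. \<mu> + sqrt v * x)"
    by (intro distr_cong) auto
  ultimately show ?thesis using False by (simp add: normal_law_def)
qed

lemma real_distribution_normal_law:
  assumes "0 \<le> v"
  shows "real_distribution (normal_law \<mu> v)"
  unfolding normal_law_eq_distr[OF assms]
proof -
  interpret real_distribution std_normal_distribution by (rule real_dist_normal_dist)
  show "real_distribution (distr std_normal_distribution borel (\<lambda>x. \<mu> + sqrt v * x))"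
    by (rule real_distribution_distr) auto
qed

lemma char_normal_law:
  assumes "0 \<le> v"
  shows "char (normal_law 0 v) a = exp (- (v * a\<^sup>2) / 2)"
proof -
  have "char (normal_law 0 v) a = (CLINT x|std_normal_distribution. iexp (a * (sqrt v * x)))"
    unfolding normal_law_eq_distr[OF assms] char_def by (subst integral_distr) auto
  also have "\<dots> = char std_normal_distribution (a * sqrt v)"
    unfolding char_def by (simp add: mult_ac)
  finally show ?thesis
    using assms by (simp add: char_std_normal_distribution power_mult_distrib mult.commute)
qed

lemma normal_law_moments:
  assumes "0 \<le> v"
  shows "integrable (normal_law \<mu> v) (\<lambda>x. x)" "(LINT x|normal_law \<mu> v. x) = \<mu>"
    and "integrable (normal_law \<mu> v) (\<lambda>x. x\<^sup>2)" "(LINT x|normal_law 0 v. x\<^sup>2) = v"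
proof -
  let ?S = std_normal_distribution
  interpret real_distribution ?S by (rule real_dist_normal_dist)
  have i1: "integrable ?S (\<lambda>x. x)" and i2: "integrable ?S (\<lambda>x. x\<^sup>2)"
    using integrable_std_normal_distribution_moment[of 1] integrable_std_normal_distribution_moment[of 2]
    by simp_all
  have e1: "(LINT x|?S. x) = 0" and e2: "(LINT x|?S. x\<^sup>2) = 1"
    using integral_std_normal_distribution_moment_odd[of 1] std_normal_distribution_even_moments(1)[of 1]
    by (simp_all add: fact_2)
  have p: "prob UNIV = 1" using prob_space by simp
  show "integrable (normal_law \<mu> v) (\<lambda>x. x)"
    unfolding normal_law_eq_distr[OF assms] by (subst integrable_distr_eq) (auto intro!: i1)
  show "(LINT x|normal_law \<mu> v. x) = \<mu>"
    unfolding normal_law_eq_distr[OF assms] by (subst integral_distr) (auto simp: i1 e1 p)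
  show "integrable (normal_law \<mu> v) (\<lambda>x. x\<^sup>2)"
    unfolding normal_law_eq_distr[OF assms]
    by (subst integrable_distr_eq) (auto simp: power2_sum power_mult_distrib i1 i2)
  show "(LINT x|normal_law 0 v. x\<^sup>2) = v"
    unfolding normal_law_eq_distr[OF assms] using assms
    by (subst integral_distr) (auto simp: power_mult_distrib i2 e2)
qed

context prob_space
begin

lemma centered_normal_char:
  assumes "centered_normal Y v"
  shows "(CLINT \<omega>|M. iexp (a * Y \<omega>)) = exp (- (v * a\<^sup>2) / 2)"
proof -
  have [measurable]: "Y \<in> borel_measurable M" and "0 \<le> v" and *: "distr M borel Y = normal_law 0 v"
    using assms by (auto simp: centered_normal_def)
  have "(CLINT \<omega>|M. iexp (a * Y \<omega>)) = char (distr M borel Y) a"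
    unfolding char_def by (subst integral_distr) auto
  then show ?thesis by (simp add: * char_normal_law[OF \<open>0 \<le> v\<close>])
qed

lemma centered_normalI_char:
  assumes [measurable]: "Y \<in> borel_measurable M" and "0 \<le> v"
    and *: "\<And>a. (CLINT \<omega>|M. iexp (a * Y \<omega>)) = exp (- (v * a\<^sup>2) / 2)"
  shows "centered_normal Y v"
proof -
  have "distr M borel Y = normal_law 0 v"
  proof (rule Levy_uniqueness)
    show "real_distribution (distr M borel Y)" by (rule real_distribution_distr) simp
    show "real_distribution (normal_law 0 v)" by (rule real_distribution_normal_law) fact
    show "char (distr M borel Y) = char (normal_law 0 v)"
      using * by (auto simp: char_normal_law[OF \<open>0 \<le> v\<close>] char_def[of "distr M borel Y"] integral_distr)
  qed
  with assms show ?thesis by (simp add: centered_normal_def)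
qed

lemma centered_normal_moments:
  assumes "centered_normal Y v"
  shows "integrable M Y" "expectation Y = 0" "integrable M (\<lambda>\<omega>. (Y \<omega>)\<^sup>2)"
    "expectation (\<lambda>\<omega>. (Y \<omega>)\<^sup>2) = v"
proof -
  have [measurable]: "Y \<in> borel_measurable M" and v: "0 \<le> v" and *: "normal_law 0 v = distr M borel Y"
    using assms by (auto simp: centered_normal_def)
  note n = normal_law_moments(1-3)[OF v, of 0, unfolded *] normal_law_moments(4)[OF v, unfolded *]
  show "integrable M Y" using n(1) by (subst (asm) integrable_distr_eq) auto
  show "expectation Y = 0" using n(2) by (subst (asm) integral_distr) auto
  show "integrable M (\<lambda>\<omega>. (Y \<omega>)\<^sup>2)" using n(3) by (subst (asm) integrable_distr_eq) auto
  show "expectation (\<lambda>\<omega>. (Y \<omega>)\<^sup>2) = v" using n(4) by (subst (asm) integral_distr) auto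
qed

lemma gaussian_rv_integrable:
  assumes "gaussian_rv M Y"
  shows "integrable M Y"
proof -
  obtain \<mu> v where [measurable]: "Y \<in> borel_measurable M" and v: "0 \<le> v"
    and *: "normal_law \<mu> v = distr M borel Y"
    using assms by (auto simp: gaussian_rv_def)
  show ?thesis
    using normal_law_moments(1)[OF v, of \<mu>, unfolded *] by (subst (asm) integrable_distr_eq) auto
qed

lemma gaussian_rv_centered:
  assumes "gaussian_rv M Y" "expectation Y = 0"
  shows "\<exists>v. centered_normal Y v"
proof -
  obtain \<mu> v where [measurable]: "Y \<in> borel_measurable M" and v: "0 \<le> v"
    and *: "distr M borel Y = normal_law \<mu> v"
    using assms by (auto simp: gaussian_rv_def)
  have "\<mu> = expectation Y"
    using normal_law_moments(2)[OF v, of \<mu>] by (simp flip: * add: integral_distr)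
  then show ?thesis
    using assms(2) v * by (auto simp: centered_normal_def)
qed

text \<open>The characteristic function of the limit is non-zero near 0, which determines the limit of
  the variances; no tightness argument is needed.\<close>

lemma centered_normal_limit:
  assumes N: "\<And>n. centered_normal (Y n) (v n)"
    and [measurable]: "Z \<in> borel_measurable M"
    and lim: "AE \<omega> in M. (\<lambda>n. Y n \<omega>) \<longlonglongrightarrow> Z \<omega>"
  shows "\<exists>s. centered_normal Z s \<and> v \<longlonglongrightarrow> s"
proof -
  have [measurable]: "Y n \<in> borel_measurable M" and v: "0 \<le> v n" for n
    using N by (auto simp: centered_normal_def)
  let ?\<phi> = "char (distr M borel Z)"
  have \<phi>: "?\<phi> a = (CLINT \<omega>|M. iexp (a * Z \<omega>))" for a
    unfolding char_def by (subst integral_distr) auto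
  have conv: "(\<lambda>n. complex_of_real (exp (- (v n * a\<^sup>2) / 2))) \<longlonglongrightarrow> ?\<phi> a" for a
  proof -
    have "(\<lambda>n. CLINT \<omega>|M. iexp (a * Y n \<omega>)) \<longlonglongrightarrow> (CLINT \<omega>|M. iexp (a * Z \<omega>))"
    proof (rule integral_dominated_convergence[where w="\<lambda>_. 1"])
      show "AE \<omega> in M. (\<lambda>n. iexp (a * Y n \<omega>)) \<longlonglongrightarrow> iexp (a * Z \<omega>)"
        using lim by eventually_elim (intro tendsto_intros)
    qed (auto simp: norm_exp_i_times)
    then show ?thesis
      using centered_normal_char[OF N] by (simp add: \<phi>)
  qed
  then have convR: "(\<lambda>n. exp (- (v n * a\<^sup>2) / 2)) \<longlonglongrightarrow> Re (?\<phi> a)" for a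
    using tendsto_Re[OF conv[of a]] by simp
  interpret Z: real_distribution "distr M borel Z" by (rule real_distribution_distr) simp
  have "isCont (\<lambda>a. Re (?\<phi> a)) 0"
    by (intro bounded_linear.isCont[OF bounded_linear_Re] Z.isCont_char)
  then have "((\<lambda>a. Re (?\<phi> a)) \<longlongrightarrow> 1) (at 0)"
    by (simp add: isCont_def Z.char_zero)
  then have "eventually (\<lambda>a. Re (?\<phi> a) > 0) (at 0)"
    by (rule order_tendstoD) simp
  then obtain a where a: "a \<noteq> 0" "Re (?\<phi> a) > 0"
    unfolding eventually_at
    by (metis UNIV_I dist_real_def field_lbound_gt_zero less_eq_real_def linorder_not_less
      abs_of_pos diff_zero zero_less_one)
  \<comment> \<open>The limit relation \<open>exp (- (v n * a\<^sup>2) / 2)\<close> to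
    \<open>Re (?\<phi> a)\<close>, solved for the variance; positivity of
    \<open>Re (?\<phi> a)\<close> makes \<open>ln\<close> continuous there.\<close>
  define s where "s = - 2 / a\<^sup>2 * ln (Re (?\<phi> a))"
  have "(\<lambda>n. - 2 / a\<^sup>2 * ln (exp (- (v n * a\<^sup>2) / 2))) \<longlonglongrightarrow> s"
    unfolding s_def using a by (intro tendsto_intros convR) auto
  then have s: "v \<longlonglongrightarrow> s" using a by (simp add: field_simps)
  then have "0 \<le> s" using v by (intro LIMSEQ_le_const[OF s]) auto
  \<comment> \<open>With the limit of the variances known, the characteristic functions converge at
    every argument, and uniqueness of limits identifies that of \<open>Z\<close>.\<close>
  have "centered_normal Z s"
  proof (rule centered_normalI_char)
    fix a :: real
    have "(\<lambda>n. complex_of_real (exp (- (v n * a\<^sup>2) / 2))) \<longlonglongrightarrow> complex_of_real (exp (- (s * a\<^sup>2) / 2))"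
      by (intro tendsto_intros s) auto
    then show "(CLINT \<omega>|M. iexp (a * Z \<omega>)) = complex_of_real (exp (- (s * a\<^sup>2) / 2))"
      using LIMSEQ_unique[OF conv] \<phi> by metis
  qed fact+
  with s show ?thesis by auto
qed

end

lemma (in prob_space) integrable_product_square:
  fixes X Z :: "'a \<Rightarrow> real"
  assumes [measurable]: "X \<in> borel_measurable M" "Z \<in> borel_measurable M"
    and "integrable M (\<lambda>\<omega>. (X \<omega>)\<^sup>2)" "integrable M (\<lambda>\<omega>. (Z \<omega>)\<^sup>2)"
  shows "integrable M (\<lambda>\<omega>. X \<omega> * Z \<omega>)"
proof (rule Bochner_Integration.integrable_bound)
  show "integrable M (\<lambda>\<omega>. (X \<omega>)\<^sup>2 + (Z \<omega>)\<^sup>2)" using assms by simp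
  have "\<bar>x * z\<bar> \<le> x\<^sup>2 + z\<^sup>2" for x z :: real
  proof -
    have "2 * (\<bar>x\<bar> * \<bar>z\<bar>) \<le> x\<^sup>2 + z\<^sup>2"
      using sum_squares_bound[of "\<bar>x\<bar>" "\<bar>z\<bar>"] by (simp add: mult.assoc)
    moreover have "0 \<le> \<bar>x\<bar> * \<bar>z\<bar>" by simp
    ultimately show ?thesis unfolding abs_mult by linarith
  qed
  then show "AE \<omega> in M. norm (X \<omega> * Z \<omega>) \<le> norm ((X \<omega>)\<^sup>2 + (Z \<omega>)\<^sup>2)" by auto
qed simp

section \<open>The Gaussian space of a centered family\<close>

locale centered_gaussian_family = prob_space M for M :: "'w measure" +
  fixes I :: "'i set" and Y :: "'i \<Rightarrow> 'w \<Rightarrow> real"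
  assumes jointly_gaussian: "jointly_gaussian M I Y"
    and mean_zero: "\<And>i. i \<in> I \<Longrightarrow> expectation (Y i) = 0"
begin

definition lin_combs :: "('w \<Rightarrow> real) set" where
  "lin_combs = {\<lambda>\<omega>. \<Sum>j\<in>J. c j * Y j \<omega> | J c. finite J \<and> J \<subseteq> I}"

text \<open>Almost sure limits replace limits in mean square; second moments converge all the same
  by \<open>centered_normal_limit\<close>. A single limit step suffices, because the integrands met
  later are themselves linear combinations of the family at each time.\<close>

definition gaussian_space :: "('w \<Rightarrow> real) set" where
  "gaussian_space = {Z \<in> borel_measurable M.
     \<exists>Zs. (\<forall>n. Zs n \<in> lin_combs) \<and> (AE \<omega> in M. (\<lambda>n. Zs n \<omega>) \<longlonglongrightarrow> Z \<omega>)}"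

lemma lin_combsI:
  "finite J \<Longrightarrow> J \<subseteq> I \<Longrightarrow> (\<lambda>\<omega>. \<Sum>j\<in>J. c j * Y j \<omega>) \<in> lin_combs"
  by (auto simp: lin_combs_def)

lemma lin_combs_family: "i \<in> I \<Longrightarrow> Y i \<in> lin_combs"
  using lin_combsI[of "{i}" "\<lambda>_. 1"] by simp

lemma lin_combs_zero: "(\<lambda>_. 0) \<in> lin_combs"
  using lin_combsI[of "{}"] by simp

lemma lin_combs_scale:
  assumes "Z \<in> lin_combs"
  shows "(\<lambda>\<omega>. a * Z \<omega>) \<in> lin_combs"
proof -
  from assms obtain J c where "Z = (\<lambda>\<omega>. \<Sum>j\<in>J. c j * Y j \<omega>)" "finite J" "J \<subseteq> I"
    by (auto simp: lin_combs_def)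
  then show ?thesis
    using lin_combsI[of J "\<lambda>j. a * c j"] by (simp add: sum_distrib_left mult.assoc)
qed

lemma lin_combs_add:
  assumes "Z \<in> lin_combs" "Z' \<in> lin_combs"
  shows "(\<lambda>\<omega>. Z \<omega> + Z' \<omega>) \<in> lin_combs"
proof -
  from assms obtain J c J' c' where Z: "Z = (\<lambda>\<omega>. \<Sum>j\<in>J. c j * Y j \<omega>)" "finite J" "J \<subseteq> I"
    "Z' = (\<lambda>\<omega>. \<Sum>j\<in>J'. c' j * Y j \<omega>)" "finite J'" "J' \<subseteq> I"
    by (auto simp: lin_combs_def)
  let ?c = "\<lambda>j. (if j \<in> J then c j else 0) + (if j \<in> J' then c' j else 0)"
  have "(\<Sum>j\<in>J. c j * Y j \<omega>) = (\<Sum>j\<in>J \<union> J'. (if j \<in> J then c j else 0) * Y j \<omega>)"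
    "(\<Sum>j\<in>J'. c' j * Y j \<omega>) = (\<Sum>j\<in>J \<union> J'. (if j \<in> J' then c' j else 0) * Y j \<omega>)" for \<omega>
    using Z by (auto intro!: sum.mono_neutral_cong_left)
  then have "(\<lambda>\<omega>. Z \<omega> + Z' \<omega>) = (\<lambda>\<omega>. \<Sum>j\<in>J \<union> J'. ?c j * Y j \<omega>)"
    unfolding Z by (simp add: sum.distrib[symmetric] distrib_right)
  then show ?thesis
    using Z lin_combsI[of "J \<union> J'" ?c] by simp
qed

lemma lin_combs_sum:
  "finite J \<Longrightarrow> (\<And>j. j \<in> J \<Longrightarrow> Z j \<in> lin_combs) \<Longrightarrow> (\<lambda>\<omega>. \<Sum>j\<in>J. Z j \<omega>) \<in> lin_combs"
  by (induction J rule: finite_induct) (auto simp: lin_combs_zero lin_combs_add)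

lemma lin_combs_measurable: "Z \<in> lin_combs \<Longrightarrow> Z \<in> borel_measurable M"
  using jointly_gaussian by (auto simp: lin_combs_def jointly_gaussian_def gaussian_rv_def)

lemma family_integrable: "i \<in> I \<Longrightarrow> integrable M (Y i)"
  using jointly_gaussian gaussian_rv_integrable[of "Y i"]
  unfolding jointly_gaussian_def
  by (force dest!: spec[of _ "{i}"] spec[of _ "\<lambda>_. 1"])

lemma lin_combs_normal:
  assumes "Z \<in> lin_combs"
  shows "\<exists>v. centered_normal Z v"
proof -
  from assms obtain J c where Z: "Z = (\<lambda>\<omega>. \<Sum>j\<in>J. c j * Y j \<omega>)" "finite J" "J \<subseteq> I"
    by (auto simp: lin_combs_def)
  have "expectation Z = 0"
    using Z mean_zero family_integrable
    by (auto simp: Bochner_Integration.integral_sum subset_eq intro!: sum.neutral)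
  with Z jointly_gaussian show ?thesis
    by (intro gaussian_rv_centered) (auto simp: jointly_gaussian_def)
qed

lemma lin_combs_subset_gaussian_space: "lin_combs \<subseteq> gaussian_space"
proof
  fix Z assume "Z \<in> lin_combs"
  then show "Z \<in> gaussian_space"
    by (auto simp: gaussian_space_def lin_combs_measurable intro!: exI[of _ "\<lambda>_. Z"])
qed

lemma gaussian_space_family: "i \<in> I \<Longrightarrow> Y i \<in> gaussian_space"
  using lin_combs_family lin_combs_subset_gaussian_space by auto

lemma gaussian_space_measurable: "Z \<in> gaussian_space \<Longrightarrow> Z \<in> borel_measurable M"
  by (simp add: gaussian_space_def)

lemma gaussian_space_scale:
  assumes "Z \<in> gaussian_space"
  shows "(\<lambda>\<omega>. a * Z \<omega>) \<in> gaussian_space"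
proof -
  from assms obtain Zs where [measurable]: "Z \<in> borel_measurable M"
    and Zs: "\<And>n. Zs n \<in> lin_combs" "AE \<omega> in M. (\<lambda>n. Zs n \<omega>) \<longlonglongrightarrow> Z \<omega>"
    by (auto simp: gaussian_space_def)
  from Zs(2) have "AE \<omega> in M. (\<lambda>n. a * Zs n \<omega>) \<longlonglongrightarrow> a * Z \<omega>"
    by eventually_elim (rule tendsto_mult_left)
  then show ?thesis
    unfolding gaussian_space_def mem_Collect_eq
    by (intro conjI exI[of _ "\<lambda>n \<omega>. a * Zs n \<omega>"]) (auto intro!: lin_combs_scale Zs)
qed

lemma gaussian_space_add:
  assumes "Z \<in> gaussian_space" "Z' \<in> gaussian_space"
  shows "(\<lambda>\<omega>. Z \<omega> + Z' \<omega>) \<in> gaussian_space"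
proof -
  from assms obtain Zs Zs' where [measurable]: "Z \<in> borel_measurable M" "Z' \<in> borel_measurable M"
    and Zs: "\<And>n. Zs n \<in> lin_combs" "AE \<omega> in M. (\<lambda>n. Zs n \<omega>) \<longlonglongrightarrow> Z \<omega>"
      "\<And>n. Zs' n \<in> lin_combs" "AE \<omega> in M. (\<lambda>n. Zs' n \<omega>) \<longlonglongrightarrow> Z' \<omega>"
    by (auto simp: gaussian_space_def)
  from Zs(2,4) have "AE \<omega> in M. (\<lambda>n. Zs n \<omega> + Zs' n \<omega>) \<longlonglongrightarrow> Z \<omega> + Z' \<omega>"
    by eventually_elim (rule tendsto_add)
  then show ?thesis
    unfolding gaussian_space_def mem_Collect_eq
    by (intro conjI exI[of _ "\<lambda>n \<omega>. Zs n \<omega> + Zs' n \<omega>"]) (auto intro!: lin_combs_add Zs)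
qed

lemma gaussian_space_diff:
  assumes "Z \<in> gaussian_space" "Z' \<in> gaussian_space"
  shows "(\<lambda>\<omega>. Z \<omega> - Z' \<omega>) \<in> gaussian_space"
  using gaussian_space_add[OF assms(1) gaussian_space_scale[OF assms(2), of "-1"]] by simp

lemma gaussian_space_sum:
  "finite J \<Longrightarrow> (\<And>j. j \<in> J \<Longrightarrow> Z j \<in> gaussian_space) \<Longrightarrow> (\<lambda>\<omega>. \<Sum>j\<in>J. Z j \<omega>) \<in> gaussian_space"
proof (induction J rule: finite_induct)
  case empty
  then show ?case using lin_combs_zero lin_combs_subset_gaussian_space by auto
qed (auto simp: gaussian_space_add)

lemma gaussian_space_normal:
  assumes "Z \<in> gaussian_space"
  shows "\<exists>v. centered_normal Z v"
proof -
  from assms obtain Zs where "Z \<in> borel_measurable M"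
    and Zs: "\<And>n. Zs n \<in> lin_combs" "AE \<omega> in M. (\<lambda>n. Zs n \<omega>) \<longlonglongrightarrow> Z \<omega>"
    by (auto simp: gaussian_space_def)
  moreover obtain v where "\<And>n. centered_normal (Zs n) (v n)"
    using lin_combs_normal[OF Zs(1)] by metis
  ultimately show ?thesis
    using centered_normal_limit[of Zs v Z] by auto
qed

lemma gaussian_space_moments:
  assumes "Z \<in> gaussian_space"
  shows "integrable M Z" "expectation Z = 0" "integrable M (\<lambda>\<omega>. (Z \<omega>)\<^sup>2)"
    "centered_normal Z (expectation (\<lambda>\<omega>. (Z \<omega>)\<^sup>2))"
  using gaussian_space_normal[OF assms] centered_normal_moments[of Z] by auto

lemma gaussian_space_integrable_product:
  assumes "Z \<in> gaussian_space" "Z' \<in> gaussian_space"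
  shows "integrable M (\<lambda>\<omega>. Z \<omega> * Z' \<omega>)"
  using assms gaussian_space_measurable gaussian_space_moments(3)
  by (intro integrable_product_square) auto

lemma gaussian_space_polarization:
  assumes "Z \<in> gaussian_space" "Z' \<in> gaussian_space"
  shows "expectation (\<lambda>\<omega>. Z \<omega> * Z' \<omega>) = (expectation (\<lambda>\<omega>. (Z \<omega> + Z' \<omega>)\<^sup>2)
    - expectation (\<lambda>\<omega>. (Z \<omega>)\<^sup>2) - expectation (\<lambda>\<omega>. (Z' \<omega>)\<^sup>2)) / 2"
  using assms gaussian_space_moments(3) gaussian_space_integrable_product[OF assms]
  by (simp add: power2_sum mult.assoc)

text \<open>For centered normal variables almost sure convergence already forces convergence of the
  variances, so uniform integrability never has to be checked.\<close>

lemma expectation_square_tendsto: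
  assumes "\<And>n. Zs n \<in> gaussian_space" "Z \<in> gaussian_space"
    and "AE \<omega> in M. (\<lambda>n. Zs n \<omega>) \<longlonglongrightarrow> Z \<omega>"
  shows "(\<lambda>n. expectation (\<lambda>\<omega>. (Zs n \<omega>)\<^sup>2)) \<longlonglongrightarrow> expectation (\<lambda>\<omega>. (Z \<omega>)\<^sup>2)"
  using centered_normal_limit[of Zs _ Z, OF gaussian_space_moments(4)[OF assms(1)]
      gaussian_space_measurable[OF assms(2)] assms(3)]
    centered_normal_moments(4) by auto

text \<open>Polarization turns a covariance into variances of members of the space, to which the
  preceding lemma applies.\<close>

lemma covariance_tendsto:
  assumes Zs: "\<And>n. Zs n \<in> gaussian_space" "Z \<in> gaussian_space" and U: "U \<in> gaussian_space"
    and lim: "AE \<omega> in M. (\<lambda>n. Zs n \<omega>) \<longlonglongrightarrow> Z \<omega>"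
  shows "(\<lambda>n. expectation (\<lambda>\<omega>. Zs n \<omega> * U \<omega>)) \<longlonglongrightarrow> expectation (\<lambda>\<omega>. Z \<omega> * U \<omega>)"
proof -
  from lim have "AE \<omega> in M. (\<lambda>n. Zs n \<omega> + U \<omega>) \<longlonglongrightarrow> Z \<omega> + U \<omega>"
    by eventually_elim (intro tendsto_intros)
  then have A: "(\<lambda>n. expectation (\<lambda>\<omega>. (Zs n \<omega> + U \<omega>)\<^sup>2)) \<longlonglongrightarrow> expectation (\<lambda>\<omega>. (Z \<omega> + U \<omega>)\<^sup>2)"
    by (intro expectation_square_tendsto gaussian_space_add Zs U)
  show ?thesis
    unfolding gaussian_space_polarization[OF Zs(1) U] gaussian_space_polarization[OF Zs(2) U]
    by (intro tendsto_divide tendsto_diff A tendsto_const expectation_square_tendsto Zs lim) simp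
qed

end

section \<open>Riemann sums, and measurability up to null sets\<close>

lemma riemann_sum_tendsto:
  fixes h :: "real \<Rightarrow> real"
  assumes h: "continuous_on {0..t} h" and t: "0 \<le> t"
  shows "(\<lambda>n. \<Sum>i<n. t / real n * h (real i * t / real n)) \<longlonglongrightarrow> integral {0..t} h"
proof (rule LIMSEQ_I)
  fix e :: real assume "0 < e"
  \<comment> \<open>Dividing by \<open>t + 1\<close> instead of \<open>t\<close> gives the strict
    bound \<open>\<epsilon> * t < e\<close> and admits \<open>t = 0\<close>.\<close>
  define \<epsilon> where "\<epsilon> = e / (t + 1)"
  have \<epsilon>: "0 < \<epsilon>" "\<epsilon> * t < e" using \<open>0 < e\<close> t by (auto simp: \<epsilon>_def field_simps)
  have "uniformly_continuous_on {0..t} h"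
    by (rule compact_uniformly_continuous[OF h compact_Icc])
  then obtain d where d: "0 < d"
    "\<And>x y. x \<in> {0..t} \<Longrightarrow> y \<in> {0..t} \<Longrightarrow> dist x y < d \<Longrightarrow> dist (h x) (h y) < \<epsilon>"
    unfolding uniformly_continuous_on_def using \<epsilon>(1) by metis
  obtain N :: nat where N: "t / d < N" using reals_Archimedean2 by blast
  show "\<exists>no. \<forall>n\<ge>no. norm ((\<Sum>i<n. t / real n * h (real i * t / real n)) - integral {0..t} h) < e"
  \<comment> \<open>\<open>Suc N\<close> keeps \<open>n\<close> positive; for \<open>n = 0\<close>
    the mesh \<open>t / n\<close> would be 0 by convention and the nodes would not reach
    \<open>t\<close>.\<close>
  proof (intro exI[of _ "Suc N"] allI impI)
    fix n :: nat assume n: "Suc N \<le> n"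
    then have n0: "real n > 0" by simp
    have "t / d < n" using N n by linarith
    then have mesh: "t / n < d" using d(1) n0 by (simp add: field_simps)
    define x where "x i = real i * t / real n" for i
    have x_mono: "x i \<le> x j" if "i \<le> j" for i j
      using that t n0 by (simp add: x_def divide_right_mono mult_right_mono)
    have x_ends: "x 0 = 0" "x n = t" using n0 by (auto simp: x_def)
    have x_sub: "{x i..x j} \<subseteq> {0..t}" if "i \<le> n" "j \<le> n" for i j
      using x_mono[of 0 i] x_mono[of j n] x_ends that by auto
    have x_Suc: "x (Suc i) - x i = t / n" for i
      by (simp add: x_def add_divide_distrib distrib_right)
    have split: "integral {0..x k} h = (\<Sum>i<k. integral {x i..x (Suc i)} h)" if "k \<le> n" for k
      using that
    proof (induction k)
      case (Suc k)
      have "integral {0..x (Suc k)} h = integral {0..x k} h + integral {x k..x (Suc k)} h"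
        using Suc.prems x_mono[of 0 k] x_mono[of k "Suc k"] x_sub[of 0 "Suc k"] x_ends
        by (intro Henstock_Kurzweil_Integration.integral_combine[symmetric]
           integrable_continuous_real continuous_on_subset[OF h]) auto
      with Suc show ?case by simp
    qed (simp add: x_ends)
    have piece: "\<bar>t / n * h (x i) - integral {x i..x (Suc i)} h\<bar> \<le> \<epsilon> * (t / n)" if "i < n" for i
    proof -
      have sub: "{x i..x (Suc i)} \<subseteq> {0..t}" using that by (intro x_sub) auto
      have le: "x i \<le> x (Suc i)" by (rule x_mono) simp
      have "norm (integral {x i..x (Suc i)} (\<lambda>y. h (x i) - h y)) \<le> \<epsilon> * (x (Suc i) - x i)"
      proof (rule integral_bound[OF le])
        show "continuous_on {x i..x (Suc i)} (\<lambda>y. h (x i) - h y)"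
          by (intro continuous_intros continuous_on_subset[OF h sub])
        fix y assume y: "y \<in> {x i..x (Suc i)}"
        have "dist (h (x i)) (h y) < \<epsilon>"
        proof (rule d(2))
          show "x i \<in> {0..t}" "y \<in> {0..t}" using sub le y by auto
          show "dist (x i) y < d" using y mesh x_Suc[of i] by (auto simp: dist_real_def)
        qed
        then show "norm (h (x i) - h y) \<le> \<epsilon>"
          by (simp add: dist_norm)
      qed
      moreover have "integral {x i..x (Suc i)} (\<lambda>y. h (x i) - h y) =
         t / n * h (x i) - integral {x i..x (Suc i)} h"
        using le x_Suc[of i] by (subst Henstock_Kurzweil_Integration.integral_diff)
         (auto intro!: integrable_continuous_real continuous_on_subset[OF h sub])
      ultimately show ?thesis using x_Suc[of i] by simp
    qed
    have "(\<Sum>i<n. t / real n * h (real i * t / real n)) - integral {0..t} h =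
        (\<Sum>i<n. t / real n * h (x i) - integral {x i..x (Suc i)} h)"
      using split[of n, unfolded x_ends(2)] by (simp add: sum_subtractf x_def)
    also have "norm \<dots> \<le> (\<Sum>i<n. \<epsilon> * (t / n))"
      by (rule sum_norm_le) (use piece in auto)
    also have "\<dots> = \<epsilon> * t" using n0 by simp
    finally show "norm ((\<Sum>i<n. t / real n * h (real i * t / real n)) - integral {0..t} h) < e"
      using \<epsilon>(2) by simp
  qed
qed

text \<open>Preimages under \<open>f\<close> and \<open>h\<close> differ only inside a null set. By
  completeness the part of the preimage under \<open>h\<close> lying in that set is itself null,
  hence belongs to the augmented \<sigma>-algebra.\<close>

lemma measurable_AE_eq_augmented:
  fixes f h :: "'a \<Rightarrow> 'b::topological_space"
  assumes "complete_measure M"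
    and G: "space G = space M" "sets G \<subseteq> sets M" "null_sets M \<subseteq> sets G"
    and f: "f \<in> borel_measurable G" and eq: "AE \<omega> in M. f \<omega> = h \<omega>"
  shows "h \<in> borel_measurable G"
proof (rule measurableI)
  interpret complete_measure M by fact
  from eq obtain N where N: "N \<in> null_sets M" "{\<omega>\<in>space M. f \<omega> \<noteq> h \<omega>} \<subseteq> N"
    by (auto elim!: AE_E2 AE_E simp: null_sets_def)
  fix A :: "'b set" assume A: "A \<in> sets borel"
  have "h -` A \<inter> N \<inter> space M \<in> sets G" "N \<in> sets G"
    using complete2[of "h -` A \<inter> N \<inter> space M" N] N(1) G(3) by auto
  moreover have "h -` A \<inter> space G = ((f -` A \<inter> space G) - N) \<union> (h -` A \<inter> N \<inter> space M)"
    using N(2) G(1) by auto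
  ultimately show "h -` A \<inter> space G \<in> sets G"
    using measurable_sets[OF f A] by (simp add: sets.Un sets.Diff)
qed simp

text \<open>\<open>lim\<close> is a total operator, so the pointwise limit is measurable even where
  the sequence diverges, and it agrees with \<open>h\<close> almost surely.\<close>

lemma measurable_AE_limit_augmented:
  fixes f :: "nat \<Rightarrow> 'a \<Rightarrow> real"
  assumes "complete_measure M"
    and G: "space G = space M" "sets G \<subseteq> sets M" "null_sets M \<subseteq> sets G"
    and f: "\<And>n. f n \<in> borel_measurable G" and lim: "AE \<omega> in M. (\<lambda>n. f n \<omega>) \<longlonglongrightarrow> h \<omega>"
  shows "h \<in> borel_measurable G"
proof (rule measurable_AE_eq_augmented[OF assms(1-4)])
  show "(\<lambda>\<omega>. lim (\<lambda>n. f n \<omega>)) \<in> borel_measurable G" using f by measurable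
  show "AE \<omega> in M. lim (\<lambda>n. f n \<omega>) = h \<omega>" using lim by eventually_elim (rule limI)
qed

lemma AE_riemann_sum_tendsto:
  fixes V :: "real \<Rightarrow> 'a \<Rightarrow> real"
  assumes "0 \<le> t" "AE \<omega> in M. continuous_on {0..t} (\<lambda>u. V u \<omega>)"
  shows "AE \<omega> in M. (\<lambda>n. \<Sum>i<n. t / real n * V (real i * t / real n) \<omega>) \<longlonglongrightarrow> integral {0..t} (\<lambda>u. V u \<omega>)"
  using assms(2) by eventually_elim (rule riemann_sum_tendsto[OF _ assms(1)])

lemma riemann_node:
  assumes "i < n" "0 \<le> t"
  shows "real i * t / real n \<in> {0..t}"
proof -
  have "real i * t \<le> real n * t" using assms by (intro mult_right_mono) auto
  then show ?thesis using assms by (auto simp: field_simps)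
qed

text \<open>The nodes of the Riemann sums lie in \<open>{0..t}\<close>, so the integral depends only
  on information up to time \<open>t\<close>; this is what later makes the drift adapted.\<close>

lemma measurable_integral_augmented:
  fixes V :: "real \<Rightarrow> 'a \<Rightarrow> real"
  assumes "complete_measure M"
    and G: "space G = space M" "sets G \<subseteq> sets M" "null_sets M \<subseteq> sets G"
    and t: "0 \<le> t" and V: "\<And>u. u \<in> {0..t} \<Longrightarrow> V u \<in> borel_measurable G"
    and cont: "AE \<omega> in M. continuous_on {0..t} (\<lambda>u. V u \<omega>)"
  shows "(\<lambda>\<omega>. integral {0..t} (\<lambda>u. V u \<omega>)) \<in> borel_measurable G"
  using V riemann_node t
  by (intro measurable_AE_limit_augmented[OF assms(1-4) _ AE_riemann_sum_tendsto[OF t cont]]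
     borel_measurable_sum borel_measurable_times) auto

context centered_gaussian_family
begin

text \<open>Since each \<open>V u\<close> is a linear combination, so are the Riemann sums, and the
  integral is a one-step limit. Comparing the limits of the expectations of the Riemann sums
  replaces Fubini's theorem, which would require joint measurability of \<open>V\<close>.\<close>

lemma gaussian_space_integral:
  fixes V :: "real \<Rightarrow> 'w \<Rightarrow> real"
  assumes "complete_measure M"
    and t: "0 \<le> t" and V: "\<And>u. u \<in> {0..t} \<Longrightarrow> V u \<in> lin_combs"
    and cont: "AE \<omega> in M. continuous_on {0..t} (\<lambda>u. V u \<omega>)"
  shows "(\<lambda>\<omega>. integral {0..t} (\<lambda>u. V u \<omega>)) \<in> gaussian_space"
    and "U \<in> gaussian_space \<Longrightarrow> expectation (\<lambda>\<omega>. integral {0..t} (\<lambda>u. V u \<omega>) * U \<omega>) =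
      integral {0..t} (\<lambda>u. expectation (\<lambda>\<omega>. V u \<omega> * U \<omega>))"
    and "U \<in> gaussian_space \<Longrightarrow> continuous_on {0..t} (\<lambda>u. expectation (\<lambda>\<omega>. V u \<omega> * U \<omega>))"
proof -
  let ?R = "\<lambda>n \<omega>. \<Sum>i<n. t / real n * V (real i * t / real n) \<omega>"
  have R: "?R n \<in> lin_combs" for n
    using riemann_node t by (intro lin_combs_sum lin_combs_scale V) auto
  note lim = AE_riemann_sum_tendsto[OF t cont]
  have "(\<lambda>\<omega>. integral {0..t} (\<lambda>u. V u \<omega>)) \<in> borel_measurable M"
    using assms(1) t V cont
    by (intro measurable_integral_augmented[of M]) (auto intro: lin_combs_measurable)
  then show int: "(\<lambda>\<omega>. integral {0..t} (\<lambda>u. V u \<omega>)) \<in> gaussian_space"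
    unfolding gaussian_space_def using R lim by (intro CollectI conjI exI[of _ ?R] allI)
  have V': "V u \<in> gaussian_space" if "u \<in> {0..t}" for u
    using V that lin_combs_subset_gaussian_space by auto
  assume U: "U \<in> gaussian_space"
  show c: "continuous_on {0..t} (\<lambda>u. expectation (\<lambda>\<omega>. V u \<omega> * U \<omega>))"
    unfolding continuous_on_sequentially
  proof (intro allI ballI impI, elim conjE)
    fix x a assume x: "\<forall>n. x n \<in> {0..t}" and a: "a \<in> {0..t}" and xa: "x \<longlonglongrightarrow> a"
    from cont have "AE \<omega> in M. (\<lambda>n. V (x n) \<omega>) \<longlonglongrightarrow> V a \<omega>"
      by eventually_elim (use x a xa in \<open>auto simp: continuous_on_sequentially o_def\<close>)
    then show "((\<lambda>u. expectation (\<lambda>\<omega>. V u \<omega> * U \<omega>)) \<circ> x) \<longlonglongrightarrow> expectation (\<lambda>\<omega>. V a \<omega> * U \<omega>)"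
      unfolding o_def using x a by (intro covariance_tendsto V' U) auto
  qed
  have "(\<lambda>n. expectation (\<lambda>\<omega>. ?R n \<omega> * U \<omega>)) \<longlonglongrightarrow>
      expectation (\<lambda>\<omega>. integral {0..t} (\<lambda>u. V u \<omega>) * U \<omega>)"
    using R lin_combs_subset_gaussian_space by (intro covariance_tendsto int U lim) auto
  moreover have "expectation (\<lambda>\<omega>. ?R n \<omega> * U \<omega>) =
     (\<Sum>i<n. t / real n * expectation (\<lambda>\<omega>. V (real i * t / real n) \<omega> * U \<omega>))" for n
  proof -
    have "integrable M (\<lambda>\<omega>. V (real i * t / real n) \<omega> * U \<omega>)" if "i < n" for i
      using riemann_node[OF that t] by (intro gaussian_space_integrable_product V' U)
    then show ?thesis
      by (simp add: sum_distrib_right mult.assoc Bochner_Integration.integral_sum)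
  qed
  ultimately show "expectation (\<lambda>\<omega>. integral {0..t} (\<lambda>u. V u \<omega>) * U \<omega>) =
      integral {0..t} (\<lambda>u. expectation (\<lambda>\<omega>. V u \<omega> * U \<omega>))"
    using riemann_sum_tendsto[OF c t] by (simp add: LIMSEQ_unique)
qed

end

subsection \<open>Independence from characteristic functions\<close>

context prob_space
begin

lemma integrable_bounded:
  fixes V :: "'a \<Rightarrow> 'b::{banach, second_countable_topology}"
  assumes "V \<in> borel_measurable M" "\<And>\<omega>. norm (V \<omega>) \<le> c"
  shows "integrable M V"
  using assms by (intro integrable_const_bound[of _ c]) auto

lemma expectation_indicator_zero_real:
  fixes Y W :: "'a \<Rightarrow> real"
  assumes [measurable]: "Y \<in> borel_measurable M" "W \<in> borel_measurable M"
    and bound: "\<And>\<omega>. \<bar>W \<omega>\<bar> \<le> c"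
    and zero: "\<And>a. (CLINT \<omega>|M. iexp (a * Y \<omega>) * of_real (W \<omega>)) = 0"
    and A[measurable]: "A \<in> sets borel"
  shows "(LINT \<omega>|M. indicator A (Y \<omega>) * W \<omega>) = 0"
proof -
  \<comment> \<open>The added 1 makes \<open>d\<close> positive even for \<open>c = 0\<close>, so
    division by \<open>d\<close> is safe and \<open>W + d\<close> is nonnegative.\<close>
  define d where "d = \<bar>c\<bar> + 1"
  have d: "d > 0" "\<And>\<omega>. - d \<le> W \<omega>" "\<And>\<omega>. \<bar>W \<omega>\<bar> \<le> d"
    using bound unfolding d_def by (auto simp: abs_le_iff intro: order_trans) (smt (verit))+
  define f where "f \<omega> = (W \<omega> + d) / d" for \<omega>
  have f_nonneg: "0 \<le> f \<omega>" for \<omega> using d(1) d(2)[of \<omega>] by (simp add: f_def)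
  have [measurable]: "f \<in> borel_measurable M" unfolding f_def by measurable
  define N where "N = distr (density M (\<lambda>\<omega>. ennreal (f \<omega>))) borel Y"
  have iW: "integrable M W" using d(3) by (intro integrable_bounded) auto
  \<comment> \<open>The hypothesis at frequency 0 is what normalises \<open>f\<close>.\<close>
  have "(LINT \<omega>|M. W \<omega>) = 0"
    using zero[of 0] by simp
  then have "(LINT \<omega>|M. f \<omega>) = 1"
    using d(1) iW by (simp add: f_def prob_space add_divide_distrib)
  moreover have "integrable M f" unfolding f_def using iW by auto
  ultimately have "(\<integral>\<^sup>+\<omega>. ennreal (f \<omega>) \<partial>M) = 1"
    using f_nonneg by (subst nn_integral_eq_integral) auto
  then have "prob_space (density M (\<lambda>\<omega>. ennreal (f \<omega>)))"
    by (intro prob_spaceI) (simp add: emeasure_density cong: nn_integral_cong)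
  then have "prob_space N"
    unfolding N_def by (rule prob_space.prob_space_distr) simp
  then have N: "real_distribution N"
    by (simp add: N_def real_distribution_def real_distribution_axioms_def)
  have "N = distr M borel Y"
  proof (rule Levy_uniqueness[OF N])
    show "real_distribution (distr M borel Y)" by (rule real_distribution_distr) simp
    show "char N = char (distr M borel Y)"
    proof
      fix a
      have i1: "integrable M (\<lambda>\<omega>. iexp (a * Y \<omega>))"
        by (intro integrable_bounded[of _ 1]) (auto simp: norm_exp_i_times)
      have i2: "integrable M (\<lambda>\<omega>. iexp (a * Y \<omega>) * of_real (W \<omega>))"
        using d(3) by (intro integrable_bounded[of _ d]) (auto simp: norm_mult norm_exp_i_times)
      have "char N a = (CLINT \<omega>|M. f \<omega> *\<^sub>R iexp (a * Y \<omega>))"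
        unfolding char_def N_def using f_nonneg
        by (subst integral_distr) (auto simp: integral_density)
      also have "\<dots> = (CLINT \<omega>|M. (iexp (a * Y \<omega>) * of_real (W \<omega>)) / of_real d + iexp (a * Y \<omega>))"
        using d(1) by (intro Bochner_Integration.integral_cong)
         (auto simp: f_def scaleR_conv_of_real field_simps)
      also have "\<dots> = (CLINT \<omega>|M. iexp (a * Y \<omega>))"
        using i1 i2 by (subst Bochner_Integration.integral_add) (use zero[of a] in auto)
      finally show "char N a = char (distr M borel Y) a"
        unfolding char_def by (simp add: integral_distr)
    qed
  qed
  then have "(LINT x|N. indicator A x) = (LINT x|distr M borel Y. indicator A x :: real)"
    by simp
  then have *: "(LINT \<omega>|M. f \<omega> * indicator A (Y \<omega>)) = (LINT \<omega>|M. indicator A (Y \<omega>))"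
    unfolding N_def using f_nonneg
    by (subst (asm) (1 2) integral_distr) (simp_all add: integral_density)
  have j1: "integrable M (\<lambda>\<omega>. indicator A (Y \<omega>) :: real)"
    by (intro integrable_bounded[of _ 1]) auto
  have j2: "integrable M (\<lambda>\<omega>. indicator A (Y \<omega>) * W \<omega>)"
    using d by (intro integrable_bounded[of _ d]) (auto split: split_indicator)
  have "(LINT \<omega>|M. f \<omega> * indicator A (Y \<omega>)) =
     (LINT \<omega>|M. (indicator A (Y \<omega>) * W \<omega>) / d + indicator A (Y \<omega>))"
    using d(1) by (intro Bochner_Integration.integral_cong) (auto simp: f_def field_simps)
  also have "\<dots> = (LINT \<omega>|M. indicator A (Y \<omega>) * W \<omega>) / d + (LINT \<omega>|M. indicator A (Y \<omega>))"
    using j1 j2 by (subst Bochner_Integration.integral_add) auto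
  finally show ?thesis using * d(1) by simp
qed

text \<open>Reduction to real and imaginary part. Both are combinations of \<open>V\<close> and its
  conjugate, and the hypothesis passes to the conjugate by replacing \<open>a\<close> with
  \<open>-a\<close>.\<close>

lemma expectation_indicator_zero:
  fixes Y :: "'a \<Rightarrow> real" and V :: "'a \<Rightarrow> complex"
  assumes [measurable]: "Y \<in> borel_measurable M" "V \<in> borel_measurable M"
    and bound: "\<And>\<omega>. norm (V \<omega>) \<le> c"
    and zero: "\<And>a. (CLINT \<omega>|M. iexp (a * Y \<omega>) * V \<omega>) = 0"
    and A[measurable]: "A \<in> sets borel"
  shows "(CLINT \<omega>|M. indicator A (Y \<omega>) * V \<omega>) = 0"
proof -
  have [measurable]: "(\<lambda>\<omega>. cnj (V \<omega>)) \<in> borel_measurable M"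
    by (rule borel_measurable_continuous_on[of cnj]) (auto intro!: continuous_intros)
  have int: "integrable M (\<lambda>\<omega>. iexp (a * Y \<omega>) * V \<omega>)"
     "integrable M (\<lambda>\<omega>. iexp (a * Y \<omega>) * cnj (V \<omega>))" for a
    using bound by (auto intro!: integrable_bounded[of _ c] simp: norm_mult norm_exp_i_times)
  have zero': "(CLINT \<omega>|M. iexp (a * Y \<omega>) * cnj (V \<omega>)) = 0" for a
  proof -
    have "(CLINT \<omega>|M. iexp (a * Y \<omega>) * cnj (V \<omega>)) = (CLINT \<omega>|M. cnj (iexp ((-a) * Y \<omega>) * V \<omega>))"
      by (simp add: exp_cnj)
    also have "\<dots> = cnj (CLINT \<omega>|M. iexp ((-a) * Y \<omega>) * V \<omega>)"
      by (rule Bochner_Integration.integral_cnj)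
    finally show ?thesis by (simp only: zero complex_cnj_zero)
  qed
  have Re: "(LINT \<omega>|M. indicator A (Y \<omega>) * Re (V \<omega>)) = 0"
  proof (rule expectation_indicator_zero_real[where c=c])
    fix a
    have "(CLINT \<omega>|M. iexp (a * Y \<omega>) * of_real (Re (V \<omega>))) =
       (CLINT \<omega>|M. (iexp (a * Y \<omega>) * V \<omega> + iexp (a * Y \<omega>) * cnj (V \<omega>)) / 2)"
      by (intro Bochner_Integration.integral_cong) (auto simp: complex_eq_iff)
    then show "(CLINT \<omega>|M. iexp (a * Y \<omega>) * of_real (Re (V \<omega>))) = 0"
      using int[of a] zero[of a] zero'[of a] by simp
  qed (use bound abs_Re_le_cmod in \<open>auto intro: order_trans\<close>)
  have Im: "(LINT \<omega>|M. indicator A (Y \<omega>) * Im (V \<omega>)) = 0"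
  proof (rule expectation_indicator_zero_real[where c=c])
    fix a
    have "(CLINT \<omega>|M. iexp (a * Y \<omega>) * of_real (Im (V \<omega>))) =
       (CLINT \<omega>|M. (iexp (a * Y \<omega>) * V \<omega> - iexp (a * Y \<omega>) * cnj (V \<omega>)) / (2 * \<i>))"
      by (intro Bochner_Integration.integral_cong) (simp_all add: complex_diff_cnj flip: right_diff_distrib, simp_all add: mult_ac)
    then show "(CLINT \<omega>|M. iexp (a * Y \<omega>) * of_real (Im (V \<omega>))) = 0"
      using int[of a] zero[of a] zero'[of a] by simp
  qed (use bound abs_Im_le_cmod in \<open>auto intro: order_trans\<close>)
  have "integrable M (\<lambda>\<omega>. indicator A (Y \<omega>) * V \<omega>)"
    using bound by (intro integrable_bounded[of _ c])
     (auto split: split_indicator intro: order_trans[OF norm_ge_zero])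
  moreover have "Re (indicator A y) = indicator A y" "Im (indicator A y) = 0" for y :: real
    by (auto split: split_indicator)
  ultimately show ?thesis
    using integral_Re[of M "\<lambda>\<omega>. indicator A (Y \<omega>) * V \<omega>"]
      integral_Im[of M "\<lambda>\<omega>. indicator A (Y \<omega>) * V \<omega>"] Re Im
    by (simp add: complex_eq_iff)
qed

text \<open>The exponentials are exchanged for indicators one coordinate at a time. An indicator
  already obtained is absorbed into the weight, which stays bounded by \<open>c\<close>; hence the
  induction must leave \<open>V\<close> arbitrary.\<close>

lemma expectation_prod_indicator_zero:
  fixes Y :: "'i \<Rightarrow> 'a \<Rightarrow> real" and V :: "'a \<Rightarrow> complex"
  assumes "finite J" "\<And>j. j \<in> J \<Longrightarrow> Y j \<in> borel_measurable M"
    and "V \<in> borel_measurable M" "\<And>\<omega>. norm (V \<omega>) \<le> c"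
    and "\<And>u. (CLINT \<omega>|M. iexp (\<Sum>j\<in>J. u j * Y j \<omega>) * V \<omega>) = 0"
    and "\<And>j. j \<in> J \<Longrightarrow> A j \<in> sets borel"
  shows "(CLINT \<omega>|M. (\<Prod>j\<in>J. indicator (A j) (Y j \<omega>)) * V \<omega>) = 0"
  using assms
proof (induction J arbitrary: V rule: finite_induct)
  case empty
  then show ?case by simp
next
  case (insert j J)
  have [measurable]: "Y j \<in> borel_measurable M" "A j \<in> sets borel" "V \<in> borel_measurable M"
    "\<And>i. i \<in> J \<Longrightarrow> Y i \<in> borel_measurable M"
    using insert.prems by auto
  have "(CLINT \<omega>|M. (\<Prod>j\<in>J. indicator (A j) (Y j \<omega>)) * (indicator (A j) (Y j \<omega>) * V \<omega>)) = 0"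
  proof (rule insert.IH)
    fix u
    have "(CLINT \<omega>|M. indicator (A j) (Y j \<omega>) * (iexp (\<Sum>j\<in>J. u j * Y j \<omega>) * V \<omega>)) = 0"
    proof (rule expectation_indicator_zero[where c=c])
      fix a
      \<comment> \<open>The frequency of the new coordinate is free in the hypothesis, so it can be
        set to \<open>a\<close> while the others are kept.\<close>
      have "(\<Sum>i\<in>insert j J. (u(j := a)) i * Y i \<omega>) = a * Y j \<omega> + (\<Sum>j\<in>J. u j * Y j \<omega>)" for \<omega>
        using insert.hyps by (auto intro!: sum.cong)
      with insert.prems(4)[of "u(j := a)"]
      show "(CLINT \<omega>|M. iexp (a * Y j \<omega>) * (iexp (\<Sum>j\<in>J. u j * Y j \<omega>) * V \<omega>)) = 0"
        by (simp add: distrib_left exp_add mult.assoc del: of_real_sum)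
    qed (use insert.prems(3) in \<open>auto simp: norm_mult norm_exp_i_times simp del: of_real_sum\<close>)
    then show "(CLINT \<omega>|M. iexp (\<Sum>j\<in>J. u j * Y j \<omega>) * (indicator (A j) (Y j \<omega>) * V \<omega>)) = 0"
      by (simp add: mult_ac)
  next
    fix \<omega> show "cmod (indicator (A j) (Y j \<omega>) * V \<omega>) \<le> c"
      using insert.prems(3)[of \<omega>] by (auto split: split_indicator intro: order_trans[OF norm_ge_zero])
  qed (use insert.prems in auto)
  then show ?case using insert.hyps by (simp add: mult_ac)
qed

section \<open>Cylinder sets as an intersection-stable generator\<close>

definition cylinders :: "'i set \<Rightarrow> ('i \<Rightarrow> 'a \<Rightarrow> real) \<Rightarrow> 'a set set" where
  "cylinders I Y = {{\<omega>\<in>space M. \<forall>j\<in>J. Y j \<omega> \<in> A j} | J A.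
     finite J \<and> J \<subseteq> I \<and> (\<forall>j. A j \<in> sets borel)}"

lemma cylinders_sets:
  assumes "\<And>j. j \<in> I \<Longrightarrow> Y j \<in> borel_measurable M"
  shows "cylinders I Y \<subseteq> events"
proof
  fix a assume "a \<in> cylinders I Y"
  then obtain J A where a: "a = {\<omega>\<in>space M. \<forall>j\<in>J. Y j \<omega> \<in> A j}" and [simp]: "finite J"
    and "J \<subseteq> I" and [measurable]: "\<And>j. A j \<in> sets borel"
    by (auto simp: cylinders_def)
  then have [measurable]: "\<And>j. j \<in> J \<Longrightarrow> Y j \<in> borel_measurable M" using assms by auto
  show "a \<in> events" unfolding a by measurable
qed

lemma Int_stable_cylinders: "Int_stable (cylinders I Y)"
proof (rule Int_stableI)
  fix a b assume "a \<in> cylinders I Y" "b \<in> cylinders I Y"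
  then obtain J A K C where
    "a = {\<omega>\<in>space M. \<forall>j\<in>J. Y j \<omega> \<in> A j}" "finite J" "J \<subseteq> I" "\<And>j. A j \<in> sets borel"
    "b = {\<omega>\<in>space M. \<forall>j\<in>K. Y j \<omega> \<in> C j}" "finite K" "K \<subseteq> I" "\<And>j. C j \<in> sets borel"
    unfolding cylinders_def by blast
  then show "a \<inter> b \<in> cylinders I Y"
    unfolding cylinders_def mem_Collect_eq
    \<comment> \<open>A coordinate constrained by only one of the two sets receives the trivial
      condition \<open>UNIV\<close> from the other.\<close>
    by (intro exI[of _ "J \<union> K"]
         exI[of _ "\<lambda>j. (if j \<in> J then A j else UNIV) \<inter> (if j \<in> K then C j else UNIV)"]) auto
qed

lemma vimage_in_cylinders:
  assumes "j \<in> I" "A \<in> sets borel"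
  shows "Y j -` A \<inter> space M \<in> cylinders I Y"
  unfolding cylinders_def mem_Collect_eq using assms
  by (intro exI[of _ "{j}"] exI[of _ "\<lambda>_. A"]) auto

lemma prod_indicator:
  assumes "finite J"
  shows "(\<Prod>j\<in>J. indicator (A j) (Y j \<omega>) :: 'b::comm_semiring_1) = indicator {\<omega>. \<forall>j\<in>J. Y j \<omega> \<in> A j} \<omega>"
  using assms by (induction J rule: finite_induct) (auto split: split_indicator)

text \<open>Intersecting with a null set gives a null set, so the union of the cylinders with the null
  sets is still closed under intersection and generates the augmented \<open>\<sigma>\<close>-algebra.\<close>

lemma indep_set_cylinders:
  fixes Y :: "'i \<Rightarrow> 'a \<Rightarrow> real" and D :: "'k \<Rightarrow> 'a \<Rightarrow> real"
  assumes Y: "\<And>j. j \<in> I \<Longrightarrow> Y j \<in> borel_measurable M"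
    and D: "\<And>k. k \<in> K \<Longrightarrow> D k \<in> borel_measurable M"
    and char: "\<And>J u L a. finite J \<Longrightarrow> J \<subseteq> I \<Longrightarrow> finite L \<Longrightarrow> L \<subseteq> K \<Longrightarrow>
      (CLINT \<omega>|M. iexp ((\<Sum>j\<in>J. u j * Y j \<omega>) + (\<Sum>k\<in>L. a k * D k \<omega>))) =
      (CLINT \<omega>|M. iexp (\<Sum>j\<in>J. u j * Y j \<omega>)) * (CLINT \<omega>|M. iexp (\<Sum>k\<in>L. a k * D k \<omega>))"
  shows "indep_set (sigma_sets (space M) (cylinders I Y \<union> null_sets M))
                   (sigma_sets (space M) (cylinders K D))"
proof (rule indep_set_sigma_sets)
  show "Int_stable (cylinders K D)" by (rule Int_stable_cylinders)
  show "Int_stable (cylinders I Y \<union> null_sets M)"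
    using cylinders_sets[of I Y, OF Y] Int_stable_cylinders[of I Y]
    by (auto simp: Int_stable_def subset_eq intro: null_set_Int1 null_set_Int2)
  show "indep_set (cylinders I Y \<union> null_sets M) (cylinders K D)"
    unfolding indep_sets2_eq
  proof (intro conjI ballI)
    show "cylinders I Y \<union> null_sets M \<subseteq> events" "cylinders K D \<subseteq> events"
      using cylinders_sets[of I Y, OF Y] cylinders_sets[of K D, OF D] by auto
    fix a b assume a: "a \<in> cylinders I Y \<union> null_sets M" and b: "b \<in> cylinders K D"
    have b_sets: "b \<in> events" using b cylinders_sets[of K D, OF D] by auto
    from a show "prob (a \<inter> b) = prob a * prob b"
    proof
      assume "a \<in> null_sets M"
      then show ?thesis
        using b_sets null_set_Int1[of a M b] by (simp add: measure_def null_setsD1 Int_commute)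
    next
      assume "a \<in> cylinders I Y"
      then obtain J A where a: "a = {\<omega>\<in>space M. \<forall>j\<in>J. Y j \<omega> \<in> A j}" and J: "finite J" "J \<subseteq> I"
        and A[measurable]: "\<And>j. A j \<in> sets borel" by (auto simp: cylinders_def)
      from b obtain L C where b: "b = {\<omega>\<in>space M. \<forall>j\<in>L. D j \<omega> \<in> C j}" and L: "finite L" "L \<subseteq> K"
        and C[measurable]: "\<And>j. C j \<in> sets borel" by (auto simp: cylinders_def)
      have [measurable]: "\<And>j. j \<in> J \<Longrightarrow> Y j \<in> borel_measurable M"
        "\<And>j. j \<in> L \<Longrightarrow> D j \<in> borel_measurable M" using J L Y D by auto
      have a_sets: "a \<in> events" unfolding a using J by measurable
      have b_sets: "b \<in> events" unfolding b using L by measurable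
      define p where "p = complex_of_real (prob a)"
      have ind_a: "indicator a \<omega> = (\<Prod>j\<in>J. indicator (A j) (Y j \<omega>) :: complex)" if "\<omega> \<in> space M" for \<omega>
        using that by (simp add: prod_indicator J a indicator_def)
      have ind_b: "indicator b \<omega> = (\<Prod>j\<in>L. indicator (C j) (D j \<omega>) :: complex)" if "\<omega> \<in> space M" for \<omega>
        using that by (simp add: prod_indicator L b indicator_def)
      have iD: "integrable M (\<lambda>\<omega>. iexp (\<Sum>k\<in>L. x k * D k \<omega>))"
        and iY: "integrable M (\<lambda>\<omega>. iexp (\<Sum>k\<in>J. y k * Y k \<omega>))"
        and iYD: "integrable M (\<lambda>\<omega>. iexp ((\<Sum>j\<in>J. y j * Y j \<omega>) + (\<Sum>k\<in>L. x k * D k \<omega>)))"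
        and iaD: "integrable M (\<lambda>\<omega>. indicator a \<omega> * iexp (\<Sum>k\<in>L. x k * D k \<omega>))" for x y
        using a_sets by (auto intro!: integrable_bounded[of _ 1] split: split_indicator
          simp: norm_mult norm_exp_i_times simp del: of_real_sum of_real_add)
      have ia: "integrable M (indicator a :: 'a \<Rightarrow> complex)"
        using a_sets by (auto intro!: integrable_bounded[of _ 1] split: split_indicator)
      have p: "(CLINT \<omega>|M. indicator a \<omega>) = p"
      proof -
        have "(CLINT \<omega>|M. indicator a \<omega>) = (CLINT \<omega>|M. of_real (indicator a \<omega>))"
          by (intro Bochner_Integration.integral_cong) (auto split: split_indicator)
        then show ?thesis using a_sets by (simp add: p_def)
      qed
      have step1: "(CLINT \<omega>|M. indicator a \<omega> * iexp (\<Sum>k\<in>L. x k * D k \<omega>)) =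
          p * (CLINT \<omega>|M. iexp (\<Sum>k\<in>L. x k * D k \<omega>))" for x
      proof -
        define e where "e = (CLINT \<omega>|M. iexp (\<Sum>k\<in>L. x k * D k \<omega>))"
        \<comment> \<open>First exchange: the exponentials of \<open>Y\<close> become the indicator
          of \<open>a\<close>, with the centered exponential of \<open>D\<close> as weight. The
          factorisation hypothesis says precisely that this weight is orthogonal to the exponentials
          of \<open>Y\<close>.\<close>
        have "(CLINT \<omega>|M. (\<Prod>j\<in>J. indicator (A j) (Y j \<omega>)) * (iexp (\<Sum>k\<in>L. x k * D k \<omega>) - e)) = 0"
        proof (rule expectation_prod_indicator_zero[where c="1 + norm e"])
          fix u
          have "(CLINT \<omega>|M. iexp (\<Sum>j\<in>J. u j * Y j \<omega>) * (iexp (\<Sum>k\<in>L. x k * D k \<omega>) - e)) =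
            (CLINT \<omega>|M. iexp ((\<Sum>j\<in>J. u j * Y j \<omega>) + (\<Sum>k\<in>L. x k * D k \<omega>)) - iexp (\<Sum>j\<in>J. u j * Y j \<omega>) * e)"
            by (simp add: right_diff_distrib distrib_left exp_add del: of_real_sum)
          also have "\<dots> = 0"
            using char[OF J L, of u x] iY iYD by (simp add: e_def del: of_real_sum of_real_add)
          finally show "(CLINT \<omega>|M. iexp (\<Sum>j\<in>J. u j * Y j \<omega>) * (iexp (\<Sum>k\<in>L. x k * D k \<omega>) - e)) = 0" .
        next
          fix \<omega> show "cmod (iexp (\<Sum>k\<in>L. x k * D k \<omega>) - e) \<le> 1 + cmod e"
            by (rule order_trans[OF norm_triangle_ineq4]) (simp add: norm_exp_i_times del: of_real_sum)
        qed (use J in auto)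
        then have "(CLINT \<omega>|M. indicator a \<omega> * (iexp (\<Sum>k\<in>L. x k * D k \<omega>) - e)) = 0"
          by (subst (asm) Bochner_Integration.integral_cong[OF refl]) (simp_all add: ind_a)
        then show ?thesis
          using iaD ia by (simp add: right_diff_distrib e_def p del: of_real_sum)
      qed
      \<comment> \<open>Second exchange, with the roles reversed: the weight is now the centered
        indicator of \<open>a\<close>, and \<open>step1\<close> supplies the orthogonality.\<close>
      have "(CLINT \<omega>|M. (\<Prod>j\<in>L. indicator (C j) (D j \<omega>)) * (indicator a \<omega> - p)) = 0"
      proof (rule expectation_prod_indicator_zero[where c="1 + norm p"])
        fix x
        have "(CLINT \<omega>|M. iexp (\<Sum>k\<in>L. x k * D k \<omega>) * (indicator a \<omega> - p)) =
          (CLINT \<omega>|M. indicator a \<omega> * iexp (\<Sum>k\<in>L. x k * D k \<omega>) - p * iexp (\<Sum>k\<in>L. x k * D k \<omega>))"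
          by (simp add: algebra_simps del: of_real_sum)
        then show "(CLINT \<omega>|M. iexp (\<Sum>k\<in>L. x k * D k \<omega>) * (indicator a \<omega> - p)) = 0"
          using iaD iD step1 by (simp del: of_real_sum)
      next
        fix \<omega> show "cmod (indicator a \<omega> - p) \<le> 1 + cmod p"
          by (rule order_trans[OF norm_triangle_ineq4]) (simp split: split_indicator)
      qed (use L a_sets in auto)
      then have "(CLINT \<omega>|M. indicator b \<omega> * (indicator a \<omega> - p)) = 0"
        by (subst (asm) Bochner_Integration.integral_cong[OF refl]) (simp_all add: ind_b)
      moreover have "(CLINT \<omega>|M. indicator b \<omega> * (indicator a \<omega> - p)) =
         (CLINT \<omega>|M. of_real (indicator (a \<inter> b) \<omega> - prob a * indicator b \<omega>))"
        by (intro Bochner_Integration.integral_cong) (auto simp: p_def split: split_indicator)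
      ultimately have "(LINT \<omega>|M. indicator (a \<inter> b) \<omega> - prob a * indicator b \<omega>) = 0"
        by (simp only: integral_complex_of_real of_real_eq_0_iff)
      then show ?thesis
        using a_sets b_sets by (subst (asm) Bochner_Integration.integral_diff) (auto simp: less_top[symmetric])
    qed
  qed
qed

end

subsection \<open>The enlarged filtration\<close>

lemma borel_measurable_vecI:
  fixes f :: "'a \<Rightarrow> real ^ 'n"
  assumes "\<And>k. (\<lambda>\<omega>. f \<omega> $ k) \<in> borel_measurable N"
  shows "f \<in> borel_measurable N"
  unfolding borel_measurable_euclidean_space[of f]
  using assms by (auto simp: Basis_vec_def inner_axis)

lemma borel_measurable_vec_nth [measurable (raw)]:
  fixes f :: "'a \<Rightarrow> real ^ 'n"
  assumes "f \<in> borel_measurable N"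
  shows "(\<lambda>\<omega>. f \<omega> $ k) \<in> borel_measurable N"
  by (rule measurable_compose[OF assms borel_measurable_continuous_onI]) (intro continuous_intros)

lemma integral_vec_nth:
  fixes f :: "real \<Rightarrow> 'a::euclidean_space ^ 'n"
  assumes "f integrable_on S"
  shows "integral S f $ k = integral S (\<lambda>u. f u $ k)"
  using integral_linear[OF assms bounded_linear_vec_nth, of k] by (simp add: o_def)

context prob_space
begin

lemma measurable_sigma_cylinders:
  assumes "j \<in> I"
  shows "Y j \<in> borel_measurable (sigma (space M) (cylinders I Y))"
proof (rule measurableI)
  fix A :: "real set" assume "A \<in> sets borel"
  then show "Y j -` A \<inter> space (sigma (space M) (cylinders I Y)) \<in> sets (sigma (space M) (cylinders I Y))"
    unfolding space_measure_of_conv using assms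
    by (intro in_measure_of vimage_in_cylinders) (auto simp: cylinders_def)
qed simp

lemma vec_vimages_subset_cylinders:
  fixes D :: "'a \<Rightarrow> real ^ 'n"
  shows "{D -` A \<inter> space M | A. A \<in> sets borel} \<subseteq>
    sigma_sets (space M) (cylinders UNIV (\<lambda>k \<omega>. D \<omega> $ k))"
proof -
  let ?N = "sigma (space M) (cylinders UNIV (\<lambda>k \<omega>. D \<omega> $ k))"
  have sp: "space ?N = space M" by (simp add: space_measure_of_conv)
  have se: "sets ?N = sigma_sets (space M) (cylinders UNIV (\<lambda>k \<omega>. D \<omega> $ k))"
    by (rule sets_measure_of) (auto simp: cylinders_def)
  have "D \<in> borel_measurable ?N"
    by (intro borel_measurable_vecI measurable_sigma_cylinders[where Y="\<lambda>k \<omega>. D \<omega> $ k"]) auto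
  from measurable_sets[OF this] show ?thesis unfolding sp se by blast
qed

end

section \<open>Uncorrelated members of the Gaussian space are independent\<close>

context centered_gaussian_family
begin

text \<open>Needed for W, whose coordinates can be exchanged with the drift integral only on paths
  where the integrand is integrable.\<close>

lemma gaussian_space_AE_cong:
  assumes "complete_measure M" "Z \<in> gaussian_space" "AE \<omega> in M. Z \<omega> = Z' \<omega>"
  shows "Z' \<in> gaussian_space"
proof -
  from assms obtain Zs where Z: "Z \<in> borel_measurable M"
    and Zs: "\<And>n. Zs n \<in> lin_combs" "AE \<omega> in M. (\<lambda>n. Zs n \<omega>) \<longlonglongrightarrow> Z \<omega>"
    by (auto simp: gaussian_space_def)
  have "Z' \<in> borel_measurable M"
    by (rule measurable_AE_eq_augmented[OF assms(1) _ _ _ Z assms(3)]) auto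
  moreover from Zs(2) assms(3) have "AE \<omega> in M. (\<lambda>n. Zs n \<omega>) \<longlonglongrightarrow> Z' \<omega>"
    by eventually_elim simp
  ultimately show ?thesis using Zs(1) by (auto simp: gaussian_space_def)
qed

lemma gaussian_space_expectation_diff:
  assumes "Z \<in> gaussian_space" "Z' \<in> gaussian_space" "U \<in> gaussian_space"
  shows "expectation (\<lambda>\<omega>. (Z \<omega> - Z' \<omega>) * U \<omega>) =
    expectation (\<lambda>\<omega>. Z \<omega> * U \<omega>) - expectation (\<lambda>\<omega>. Z' \<omega> * U \<omega>)"
  using gaussian_space_integrable_product assms by (simp add: left_diff_distrib)

lemma gaussian_space_expectation_sum:
  assumes "finite J" "\<And>j. j \<in> J \<Longrightarrow> Z j \<in> gaussian_space" "U \<in> gaussian_space"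
  shows "expectation (\<lambda>\<omega>. (\<Sum>j\<in>J. c j * Z j \<omega>) * U \<omega>) = (\<Sum>j\<in>J. c j * expectation (\<lambda>\<omega>. Z j \<omega> * U \<omega>))"
  using gaussian_space_integrable_product assms
  by (simp add: sum_distrib_right Bochner_Integration.integral_sum mult.assoc)

text \<open>With zero covariance the variances add, and the characteristic function of a centered
  normal variable is multiplicative in the variance. Frequency 1 is enough because the space is
  closed under scaling.\<close>

lemma gaussian_space_char_add:
  assumes UV: "U \<in> gaussian_space" "V \<in> gaussian_space" and "expectation (\<lambda>\<omega>. U \<omega> * V \<omega>) = 0"
  shows "(CLINT \<omega>|M. iexp (U \<omega> + V \<omega>)) = (CLINT \<omega>|M. iexp (U \<omega>)) * (CLINT \<omega>|M. iexp (V \<omega>))"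
proof -
  have "expectation (\<lambda>\<omega>. (U \<omega> + V \<omega>)\<^sup>2) = expectation (\<lambda>\<omega>. (U \<omega>)\<^sup>2) + expectation (\<lambda>\<omega>. (V \<omega>)\<^sup>2)"
    using gaussian_space_polarization[OF UV] assms(3) by simp
  then show ?thesis
    using centered_normal_char[OF gaussian_space_moments(4)[OF UV(1)], of 1]
      centered_normal_char[OF gaussian_space_moments(4)[OF UV(2)], of 1]
      centered_normal_char[OF gaussian_space_moments(4)[OF gaussian_space_add[OF UV]], of 1]
    by (simp add: add_divide_distrib exp_add[symmetric] flip: of_real_mult of_real_add)
qed

text \<open>Every linear combination on one side is uncorrelated with every one on the other, so the
  characteristic functions factorise. No density appears, so singular covariance matrices are
  included.\<close>

lemma gaussian_space_indep_set:
  assumes Z: "\<And>j. j \<in> J \<Longrightarrow> Z j \<in> gaussian_space" and D: "\<And>k. k \<in> K \<Longrightarrow> D k \<in> gaussian_space"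
    and cov: "\<And>j k. j \<in> J \<Longrightarrow> k \<in> K \<Longrightarrow> expectation (\<lambda>\<omega>. D k \<omega> * Z j \<omega>) = 0"
  shows "indep_set (sigma_sets (space M) (cylinders J Z \<union> null_sets M))
                   (sigma_sets (space M) (cylinders K D))"
proof (rule indep_set_cylinders)
  fix J' u K' a assume fin: "finite J'" "J' \<subseteq> J" "finite K'" "K' \<subseteq> K"
  have S: "(\<lambda>\<omega>. \<Sum>j\<in>J'. u j * Z j \<omega>) \<in> gaussian_space" "(\<lambda>\<omega>. \<Sum>k\<in>K'. a k * D k \<omega>) \<in> gaussian_space"
    using fin by (auto intro!: gaussian_space_sum gaussian_space_scale Z D)
  have "expectation (\<lambda>\<omega>. Z j \<omega> * (\<Sum>k\<in>K'. a k * D k \<omega>)) = 0" if "j \<in> J'" for j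
  proof -
    have "expectation (\<lambda>\<omega>. (\<Sum>k\<in>K'. a k * D k \<omega>) * Z j \<omega>) = 0"
      using that fin by (subst gaussian_space_expectation_sum) (auto intro!: Z D sum.neutral simp: cov subset_eq)
    then show ?thesis by (simp add: mult.commute)
  qed
  then have "expectation (\<lambda>\<omega>. (\<Sum>j\<in>J'. u j * Z j \<omega>) * (\<Sum>k\<in>K'. a k * D k \<omega>)) = 0"
    using fin S by (subst gaussian_space_expectation_sum) (auto intro!: Z sum.neutral)
  from gaussian_space_char_add[OF S this]
  show "(CLINT \<omega>|M. iexp ((\<Sum>j\<in>J'. u j * Z j \<omega>) + (\<Sum>k\<in>K'. a k * D k \<omega>))) =
      (CLINT \<omega>|M. iexp (\<Sum>j\<in>J'. u j * Z j \<omega>)) * (CLINT \<omega>|M. iexp (\<Sum>k\<in>K'. a k * D k \<omega>))" .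
qed (use Z D gaussian_space_measurable in auto)

end

section \<open>Joint second moments of X and B\<close>

locale gaussian_enlargement = prob_space M for M :: "'w measure" +
  fixes T :: real
    and B :: "real \<Rightarrow> 'w \<Rightarrow> real ^ 'n"
    and X :: "'w \<Rightarrow> real ^ 'm"
    and \<Sigma> :: "real ^ 'm ^ 'm"
    and \<rho> :: "real \<Rightarrow> real ^ 'm ^ 'n"
  assumes complete: "complete_measure M"
    and T_pos: "T > 0"
    and bm: "standard_brownian_motion M T B"
    and X: "centered_gaussian_vector M X \<Sigma>"
    and jg: "jointly_gaussian M (UNIV <+> ({0..T} \<times> UNIV)) (component_family X B)"
    and outer: "\<And>t. t \<in> {0..T} \<Longrightarrow> (LINT \<omega>|M. outer_product (B t \<omega>) (X \<omega>)) = \<rho> t"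
begin

abbreviation "indices t \<equiv> UNIV <+> ({0..t} \<times> UNIV) :: ('m + real \<times> 'n) set"

lemma family_rv:
  assumes "i \<in> indices T"
  shows "component_family X B i \<in> borel_measurable M" "integrable M (component_family X B i)"
proof -
  have "gaussian_rv M (component_family X B i)"
    using jg[unfolded jointly_gaussian_def, rule_format, of "{i}" "\<lambda>_. 1"] assms by simp
  then show "component_family X B i \<in> borel_measurable M" "integrable M (component_family X B i)"
    by (auto simp: gaussian_rv_integrable) (simp add: gaussian_rv_def)
qed

lemma X_eq: "(\<lambda>\<omega>. X \<omega> $ j) = component_family X B (Inl j)"
  by (simp add: component_family_def fun_eq_iff)

lemma B_eq: "(\<lambda>\<omega>. B t \<omega> $ k) = component_family X B (Inr (t, k))"
  by (simp add: component_family_def fun_eq_iff)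

lemma X_comp_measurable [measurable]: "(\<lambda>\<omega>. X \<omega> $ j) \<in> borel_measurable M"
  unfolding X_eq by (rule family_rv) auto

lemma B_comp_measurable: "t \<in> {0..T} \<Longrightarrow> (\<lambda>\<omega>. B t \<omega> $ k) \<in> borel_measurable M"
  unfolding B_eq by (rule family_rv) auto

lemma X_measurable [measurable]: "X \<in> borel_measurable M"
  by (rule borel_measurable_vecI) simp

lemma B_measurable: "t \<in> {0..T} \<Longrightarrow> B t \<in> borel_measurable M"
  by (rule borel_measurable_vecI) (rule B_comp_measurable)

lemma B_0: "AE \<omega> in M. B 0 \<omega> = 0"
  and B_continuous: "AE \<omega> in M. continuous_on {0..T} (\<lambda>t. B t \<omega>)"
  using bm unfolding standard_brownian_motion_def brownian_motion_wrt_def by auto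

lemma B_increment:
  assumes "0 \<le> s" "s < t" "t \<le> T"
  shows "indep_set (sets (natural_filtration M B s))
          {(\<lambda>\<omega>. B t \<omega> - B s \<omega>) -` A \<inter> space M | A. A \<in> sets borel}"
    and "centered_gaussian_vector M (\<lambda>\<omega>. B t \<omega> - B s \<omega>) ((t - s) *\<^sub>R mat 1)"
  using bm assms unfolding standard_brownian_motion_def brownian_motion_wrt_def by auto

lemma B_integrable: "t \<in> {0..T} \<Longrightarrow> integrable M (\<lambda>\<omega>. B t \<omega> $ k)"
  unfolding B_eq by (rule family_rv) auto

lemma B_increment_mean:
  assumes "0 \<le> s" "s < t" "t \<le> T"
  shows "expectation (\<lambda>\<omega>. (B t \<omega> - B s \<omega>) $ k) = 0"
  using B_increment(2)[OF assms] unfolding centered_gaussian_vector_def by blast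

text \<open>Only increments over nondegenerate intervals have a prescribed law, so the mean is read
  off from the increment starting at time 0, where B vanishes almost surely; time 0 is
  separate.\<close>

lemma B_mean:
  assumes "t \<in> {0..T}"
  shows "expectation (\<lambda>\<omega>. B t \<omega> $ k) = 0"
proof (cases "t = 0")
  case True
  then show ?thesis
    using B_0 by (intro integral_eq_zero_AE) auto
next
  case False
  then have "expectation (\<lambda>\<omega>. (B t \<omega> - B 0 \<omega>) $ k) = 0"
    using assms by (intro B_increment_mean) auto
  moreover have "expectation (\<lambda>\<omega>. (B t \<omega> - B 0 \<omega>) $ k) = expectation (\<lambda>\<omega>. B t \<omega> $ k)"
    using B_0 assms T_pos B_comp_measurable[of t k] B_comp_measurable[of 0 k]
    by (intro integral_cong_AE) auto
  ultimately show ?thesis by simp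
qed

sublocale centered_gaussian_family M "indices T" "component_family X B"
proof
  fix i assume i: "i \<in> indices T"
  show "expectation (component_family X B i) = 0"
  proof (cases i)
    case (Inl j)
    then show ?thesis using X by (simp add: centered_gaussian_vector_def flip: X_eq)
  next
    case (Inr p)
    then show ?thesis using i B_mean[of "fst p" "snd p"] by (auto simp flip: B_eq)
  qed
qed (rule jg)

lemma X_lin_combs: "(\<lambda>\<omega>. X \<omega> $ j) \<in> lin_combs"
  unfolding X_eq by (rule lin_combs_family) auto

lemma B_lin_combs: "t \<in> {0..T} \<Longrightarrow> (\<lambda>\<omega>. B t \<omega> $ k) \<in> lin_combs"
  unfolding B_eq by (rule lin_combs_family) auto

lemma X_gaussian_space: "(\<lambda>\<omega>. X \<omega> $ j) \<in> gaussian_space"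
  using X_lin_combs lin_combs_subset_gaussian_space by blast

lemma B_gaussian_space: "t \<in> {0..T} \<Longrightarrow> (\<lambda>\<omega>. B t \<omega> $ k) \<in> gaussian_space"
  using B_lin_combs lin_combs_subset_gaussian_space by blast

text \<open>No means are subtracted: the vectors it is applied to are centered.\<close>

definition cov :: "('w \<Rightarrow> real ^ 'a) \<Rightarrow> ('w \<Rightarrow> real ^ 'b) \<Rightarrow> real ^ 'b ^ 'a" where
  "cov U V = (\<chi> i j. expectation (\<lambda>\<omega>. U \<omega> $ i * V \<omega> $ j))"

lemma cov_transpose: "cov U V = transpose (cov V U)"
  by (simp add: cov_def transpose_def mult.commute)

lemma cov_X_X: "cov X X = \<Sigma>"
proof -
  have "expectation (\<lambda>\<omega>. X \<omega> $ i) = 0" for i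
    using X by (simp add: centered_gaussian_vector_def)
  then show ?thesis
    using X by (simp add: centered_gaussian_vector_def covariance_matrix_def cov_def)
qed

text \<open>The hypothesis on \<rho> is a matrix-valued Bochner integral. Coordinates commute with
  it only once integrability is known, which is assembled from the entries.\<close>

lemma cov_B_X:
  assumes t: "t \<in> {0..T}"
  shows "cov (B t) X = \<rho> t"
proof -
  let ?P = "\<lambda>\<omega>. outer_product (B t \<omega>) (X \<omega>)"
  have comp: "integrable M (\<lambda>\<omega>. ?P \<omega> $ i $ j)" for i j
    using gaussian_space_integrable_product[OF B_gaussian_space[OF t] X_gaussian_space]
    by (simp add: outer_product_def)
  have "integrable M (\<lambda>\<omega>. \<Sum>b\<in>Basis. (?P \<omega> \<bullet> b) *\<^sub>R b)"
    using comp by (intro Bochner_Integration.integrable_sum integrable_scaleR_left)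
      (auto simp: Basis_vec_def inner_axis)
  then have P: "integrable M ?P" by (simp add: euclidean_representation)
  have "(LINT \<omega>|M. ?P \<omega>) $ i $ j = (LINT \<omega>|M. ?P \<omega> $ i $ j)" for i j
    using integral_bounded_linear[OF bounded_linear_compose[OF bounded_linear_vec_nth[of j]
       bounded_linear_vec_nth[of i]] P] by simp
  then show ?thesis
    using outer[OF t] by (simp add: vec_eq_iff cov_def outer_product_def)
qed

lemma cov_B_B:
  assumes s: "s \<in> {0..T}" and t: "t \<in> {0..T}"
  shows "cov (B s) (B t) = min s t *\<^sub>R mat 1"
proof -
  have diag: "cov (B t) (B t) = t *\<^sub>R mat 1" if t: "t \<in> {0..T}" for t
  proof (cases "t = 0")
    case True
    have "expectation (\<lambda>\<omega>. B 0 \<omega> $ i * B 0 \<omega> $ j) = 0" for i j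
      using B_0 by (intro integral_eq_zero_AE) auto
    then show ?thesis using True by (simp add: cov_def vec_eq_iff)
  next
    case False
    have "covariance_matrix M (\<lambda>\<omega>. B t \<omega> - B 0 \<omega>) = t *\<^sub>R mat 1"
      using B_increment(2)[of 0 t] t False by (auto simp: centered_gaussian_vector_def)
    moreover have "covariance_matrix M (\<lambda>\<omega>. B t \<omega> - B 0 \<omega>) =
      (\<chi> i j. expectation (\<lambda>\<omega>. (B t \<omega> - B 0 \<omega>) $ i * (B t \<omega> - B 0 \<omega>) $ j))"
      using B_increment_mean[of 0 t] t False unfolding covariance_matrix_def by auto
    moreover have "expectation (\<lambda>\<omega>. (B t \<omega> - B 0 \<omega>) $ i * (B t \<omega> - B 0 \<omega>) $ j) =
      expectation (\<lambda>\<omega>. B t \<omega> $ i * B t \<omega> $ j)" for i j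
      using B_0 t T_pos B_comp_measurable[of t] B_comp_measurable[of 0]
      by (intro integral_cong_AE) auto
    ultimately show ?thesis by (simp add: cov_def)
  qed
  \<comment> \<open>B_t is B_s plus an increment independent of it, so only the variance of B_s
    remains.\<close>
  have less: "cov (B s) (B t) = s *\<^sub>R mat 1" if st: "0 \<le> s" "s < t" "t \<le> T" for s t
  proof -
    have s: "s \<in> {0..T}" and t: "t \<in> {0..T}" using st by auto
    let ?D = "\<lambda>\<omega>. B t \<omega> - B s \<omega>"
    let ?V = "{?D -` A \<inter> space M | A. A \<in> sets borel}"
    have "expectation (\<lambda>\<omega>. B s \<omega> $ i * ?D \<omega> $ j) = 0" for i j
    proof -
      have D_gs: "(\<lambda>\<omega>. ?D \<omega> $ j) \<in> gaussian_space"
        using gaussian_space_diff[OF B_gaussian_space[OF t] B_gaussian_space[OF s]] by simp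
      \<comment> \<open>The preimages of Borel sets already form a \<sigma>-algebra, so independence
        passes to each coordinate of the increment.\<close>
      have V: "?V = sets (vimage_algebra (space M) ?D borel)"
        by (subst sets_vimage_algebra2) auto
      have [measurable]: "B s \<in> measurable (natural_filtration M B s) borel"
        unfolding natural_filtration_def using st
        by (intro measurableI) (auto simp: space_measure_of_conv intro!: in_measure_of bexI[of _ s] exI)
      have Bs: "(\<lambda>\<omega>. B s \<omega> $ i) \<in> borel_measurable (natural_filtration M B s)"
        by measurable
      have "sigma_sets (space M) {(\<lambda>\<omega>. B s \<omega> $ i) -` A \<inter> space M | A. A \<in> sets borel}
         \<subseteq> sets (natural_filtration M B s)"
      proof -
        have sp: "space (natural_filtration M B s) = space M"
          unfolding natural_filtration_def by (simp add: space_measure_of_conv)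
        have "{(\<lambda>\<omega>. B s \<omega> $ i) -` A \<inter> space M | A. A \<in> sets borel} \<subseteq> sets (natural_filtration M B s)"
          using measurable_sets[OF Bs] by (auto simp: sp)
        from sets.sigma_sets_subset[OF this] show ?thesis by (simp only: sp)
      qed
      moreover have "sigma_sets (space M) {(\<lambda>\<omega>. ?D \<omega> $ j) -` A \<inter> space M | A. A \<in> sets borel} \<subseteq> ?V"
      proof -
        have [measurable]: "?D \<in> measurable (vimage_algebra (space M) ?D borel) borel"
          by (rule measurable_vimage_algebra1) auto
        have D: "(\<lambda>\<omega>. ?D \<omega> $ j) \<in> borel_measurable (vimage_algebra (space M) ?D borel)"
          by measurable
        have "{(\<lambda>\<omega>. ?D \<omega> $ j) -` A \<inter> space M | A. A \<in> sets borel} \<subseteq> ?V"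
          unfolding V using measurable_sets[OF D] by auto
        from sets.sigma_sets_subset[OF this[unfolded V]] show ?thesis
          unfolding V by simp
      qed
      ultimately have "indep_set (sigma_sets (space M) {(\<lambda>\<omega>. B s \<omega> $ i) -` A \<inter> space M | A. A \<in> sets borel})
        (sigma_sets (space M) {(\<lambda>\<omega>. ?D \<omega> $ j) -` A \<inter> space M | A. A \<in> sets borel})"
        using B_increment(1)[OF st] unfolding indep_sets2_eq by (meson order_trans subsetD)
      then have "indep_var borel (\<lambda>\<omega>. B s \<omega> $ i) borel (\<lambda>\<omega>. ?D \<omega> $ j)"
        unfolding indep_var_eq using B_comp_measurable[OF s] gaussian_space_measurable[OF D_gs] by auto
      then show ?thesis
        using B_integrable[OF s] gaussian_space_moments(1)[OF D_gs] B_mean[OF s]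
        by (subst indep_var_lebesgue_integral) auto
    qed
    moreover have "expectation (\<lambda>\<omega>. B s \<omega> $ i * B t \<omega> $ j) =
       expectation (\<lambda>\<omega>. B s \<omega> $ i * B s \<omega> $ j) + expectation (\<lambda>\<omega>. B s \<omega> $ i * ?D \<omega> $ j)" for i j
      using gaussian_space_integrable_product[OF B_gaussian_space[OF s] B_gaussian_space[OF s]]
        gaussian_space_integrable_product[OF B_gaussian_space[OF s] B_gaussian_space[OF t]]
      by (simp add: right_diff_distrib)
    ultimately show ?thesis using diag[OF s] by (simp add: cov_def)
  qed
  consider "s < t" | "t < s" | "s = t" by linarith
  then show ?thesis
  proof cases
    case 1 then show ?thesis using less s t by simp
  next
    case 2
    then have "cov (B t) (B s) = t *\<^sub>R mat 1" using less s t by simp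
    then show ?thesis using 2 by (subst cov_transpose) (simp add: transpose_scaleR transpose_mat)
  next
    case 3 then show ?thesis using diag t by simp
  qed
qed

lemma \<Sigma>_symmetric: "transpose \<Sigma> = \<Sigma>"
  using cov_transpose[of X X] by (simp add: cov_X_X)

lemma \<rho>_zero: "\<rho> 0 = 0"
proof -
  have "expectation (\<lambda>\<omega>. B 0 \<omega> $ i * X \<omega> $ j) = 0" for i j
    using B_0 by (intro integral_eq_zero_AE) auto
  then show ?thesis
    using cov_B_X[of 0] T_pos by (simp add: cov_def vec_eq_iff)
qed

end

section \<open>The process W: covariances, adaptedness, paths and independence\<close>

locale gaussian_enlargement_kernel =
  gaussian_enlargement M T B X \<Sigma> \<rho> + drift_kernel T \<Sigma> \<rho> \<rho>' \<rho>'' g g'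
  for M :: "'w measure" and T :: real and B :: "real \<Rightarrow> 'w \<Rightarrow> real ^ 'n" and X :: "'w \<Rightarrow> real ^ 'm"
    and \<Sigma> :: "real ^ 'm ^ 'm" and \<rho> \<rho>' \<rho>'' g g' :: "real \<Rightarrow> real ^ 'm ^ 'n"
begin

definition W :: "real \<Rightarrow> 'w \<Rightarrow> real ^ 'n" where
  "W t \<omega> = B t \<omega> - integral {0..t} (\<lambda>u. kernel t u *v B u \<omega>) - g t *v X \<omega>"

abbreviation "G \<equiv> augmented M (enlarged_filtration M X B)"

lemma drift_continuous:
  assumes "t \<in> {0..T}"
  shows "AE \<omega> in M. continuous_on {0..t} (\<lambda>u. kernel t u *v B u \<omega>)"
  using B_continuous
proof eventually_elim
  case (elim \<omega>)
  have "{0..t} \<subseteq> {0..T}" using assms by auto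
  then show ?case
    by (intro bounded_bilinear.continuous_on[OF bounded_bilinear_matrix_vector_mult]
      continuous_on_subset[OF kernel_cont] continuous_on_subset[OF elim])
qed

lemma drift_comp_continuous:
  assumes "t \<in> {0..T}"
  shows "AE \<omega> in M. continuous_on {0..t} (\<lambda>u. (kernel t u *v B u \<omega>) $ k)"
  using drift_continuous[OF assms]
  by eventually_elim (intro continuous_intros)

lemma drift_comp_lin_combs:
  assumes "u \<in> {0..T}"
  shows "(\<lambda>\<omega>. (A *v B u \<omega>) $ k) \<in> lin_combs"
  unfolding matrix_vector_mult_def by (auto intro!: lin_combs_sum lin_combs_scale B_lin_combs assms)

lemma W_comp:
  assumes "t \<in> {0..T}"
  shows "AE \<omega> in M. B t \<omega> $ k - integral {0..t} (\<lambda>u. (kernel t u *v B u \<omega>) $ k)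
     - (\<Sum>j\<in>UNIV. g t $ k $ j * X \<omega> $ j) = W t \<omega> $ k"
  using drift_continuous[OF assms]
  by eventually_elim
    (simp add: W_def integral_vec_nth integrable_continuous_real matrix_vector_mult_def)

lemma drift_gaussian_space:
  assumes "t \<in> {0..T}"
  shows "(\<lambda>\<omega>. integral {0..t} (\<lambda>u. (kernel t u *v B u \<omega>) $ k)) \<in> gaussian_space"
  using assms by (intro gaussian_space_integral complete drift_comp_continuous drift_comp_lin_combs) auto

lemma W_gaussian_space:
  assumes "t \<in> {0..T}"
  shows "(\<lambda>\<omega>. W t \<omega> $ k) \<in> gaussian_space"
  using assms
  by (intro gaussian_space_AE_cong[OF complete _ W_comp] gaussian_space_diff gaussian_space_sum
     gaussian_space_scale B_gaussian_space X_gaussian_space drift_gaussian_space) auto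

text \<open>The bridge between the two halves: expectation commutes with the drift integral by
  \<open>gaussian_space_integral\<close>, and linearity does the rest, entry by entry.\<close>

lemma cov_W:
  fixes U :: "'w \<Rightarrow> real ^ 'd"
  assumes t: "t \<in> {0..T}" and U: "\<And>k. (\<lambda>\<omega>. U \<omega> $ k) \<in> gaussian_space"
  shows "cov (W t) U = L (\<lambda>u. cov (B u) U) (cov X U) t"
proof -
  have sub: "u \<in> {0..T}" if "u \<in> {0..t}" for u using that t by auto
  \<comment> \<open>Makes the matrix-valued integrand integrable, so that its integral can be taken
    entrywise at the end.\<close>
  have c: "continuous_on {0..t} (\<lambda>u. cov (B u) U)"
  proof -
    have "continuous_on {0..t} (\<lambda>u. expectation (\<lambda>\<omega>. B u \<omega> $ i * U \<omega> $ j))" for i j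
    proof (rule gaussian_space_integral(3)[OF complete _ _ _ U])
      show "AE \<omega> in M. continuous_on {0..t} (\<lambda>u. B u \<omega> $ i)"
        using B_continuous
        by eventually_elim (use sub in \<open>auto intro!: continuous_intros elim: continuous_on_subset\<close>)
    qed (use t sub B_lin_combs in auto)
    then show ?thesis unfolding cov_def by (intro continuous_on_vec_lambda)
  qed
  have int: "(\<lambda>u. kernel t u ** cov (B u) U) integrable_on {0..t}"
    using sub by (intro integrable_continuous_real continuous_intros c
      continuous_on_subset[OF kernel_cont]) auto
  have "cov (W t) U $ k $ l = L (\<lambda>u. cov (B u) U) (cov X U) t $ k $ l" for k l
  proof -
    let ?I = "\<lambda>\<omega>. integral {0..t} (\<lambda>u. (kernel t u *v B u \<omega>) $ k)"
    let ?S = "\<lambda>\<omega>. \<Sum>j\<in>UNIV. g t $ k $ j * X \<omega> $ j"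
    have S: "?S \<in> gaussian_space"
      by (intro gaussian_space_sum gaussian_space_scale X_gaussian_space) auto
    have "cov (W t) U $ k $ l = expectation (\<lambda>\<omega>. W t \<omega> $ k * U \<omega> $ l)"
      by (simp add: cov_def)
    also have "\<dots> = expectation (\<lambda>\<omega>. (B t \<omega> $ k - ?I \<omega> - ?S \<omega>) * U \<omega> $ l)"
      using W_comp[OF t, of k] gaussian_space_measurable[OF W_gaussian_space[OF t]]
        gaussian_space_measurable[OF U] gaussian_space_measurable[OF B_gaussian_space[OF t]]
        gaussian_space_measurable[OF drift_gaussian_space[OF t]] gaussian_space_measurable[OF S]
      by (intro integral_cong_AE) auto
    also have "\<dots> = expectation (\<lambda>\<omega>. B t \<omega> $ k * U \<omega> $ l) - expectation (\<lambda>\<omega>. ?I \<omega> * U \<omega> $ l)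
        - expectation (\<lambda>\<omega>. ?S \<omega> * U \<omega> $ l)"
      using t S U by (simp add: gaussian_space_expectation_diff gaussian_space_diff B_gaussian_space
         drift_gaussian_space)
    also have "expectation (\<lambda>\<omega>. ?S \<omega> * U \<omega> $ l) = (g t ** cov X U) $ k $ l"
      using U by (subst gaussian_space_expectation_sum)
        (auto simp: X_gaussian_space matrix_matrix_mult_def cov_def)
    also have "expectation (\<lambda>\<omega>. ?I \<omega> * U \<omega> $ l) =
       integral {0..t} (\<lambda>u. expectation (\<lambda>\<omega>. (kernel t u *v B u \<omega>) $ k * U \<omega> $ l))"
      using t sub by (intro gaussian_space_integral complete drift_comp_continuous
          drift_comp_lin_combs U) auto
    also have "\<dots> = integral {0..t} (\<lambda>u. (kernel t u ** cov (B u) U) $ k $ l)"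
    proof (rule integral_cong)
      fix u assume "u \<in> {0..t}"
      then show "expectation (\<lambda>\<omega>. (kernel t u *v B u \<omega>) $ k * U \<omega> $ l) =
          (kernel t u ** cov (B u) U) $ k $ l"
        using U sub unfolding matrix_vector_mult_def
        by (simp, subst gaussian_space_expectation_sum)
          (auto simp: B_gaussian_space matrix_matrix_mult_def cov_def)
    qed
    also have "\<dots> = integral {0..t} (\<lambda>u. kernel t u ** cov (B u) U) $ k $ l"
      using integrable_linear[OF int bounded_linear_vec_nth[of k], unfolded o_def]
      by (simp only: integral_vec_nth[OF int] integral_vec_nth)
    finally show ?thesis by (simp add: L_def cov_def)
  qed
  then show ?thesis by (simp add: vec_eq_iff)
qed

lemma L_cong:
  assumes "\<And>u. u \<in> {0..t} \<Longrightarrow> c u = c' u" "0 \<le> t"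
  shows "L c x t = L c' x t"
  unfolding L_def using assms by (auto intro!: integral_cong)

lemma cov_W_X:
  assumes t: "t \<in> {0..T}"
  shows "cov (W t) X = 0"
proof -
  have "cov (W t) X = L \<rho> \<Sigma> t"
    unfolding cov_W[OF t X_gaussian_space] cov_X_X
    using t by (intro L_cong) (auto simp: cov_B_X)
  then show ?thesis by (simp add: L_\<rho>[OF t])
qed

lemma cov_W_B:
  assumes "0 \<le> r" "r \<le> t" "t \<le> T"
  shows "cov (W t) (B r) = \<psi> r"
proof -
  have t: "t \<in> {0..T}" and r: "r \<in> {0..T}" using assms by auto
  have "cov (W t) (B r) = L (\<lambda>u. min u r *\<^sub>R mat 1) (transpose (\<rho> r)) t"
    unfolding cov_W[OF t B_gaussian_space[OF r]] cov_transpose[of X] cov_B_X[OF r]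
    using assms r by (intro L_cong) (auto simp: cov_B_B)
  then show ?thesis using assms by (simp add: L_min)
qed

text \<open>It is W at the earlier time that is expanded: its drift involves B_u with
  \<open>u \<le> s\<close> only, and there \<open>cov_W_B\<close> gives the covariance with W at the
  later time.\<close>

lemma cov_W_W:
  assumes "0 \<le> s" "s \<le> t" "t \<le> T"
  shows "cov (W s) (W t) = s *\<^sub>R mat 1"
proof -
  have t: "t \<in> {0..T}" and s: "s \<in> {0..T}" using assms by auto
  have "cov (W s) (W t) = L (\<lambda>u. transpose (\<psi> u)) 0 s"
    unfolding cov_W[OF s W_gaussian_space[OF t]] cov_transpose[of X] cov_W_X[OF t] transpose_zero
    using assms by (intro L_cong) (auto simp: cov_transpose[of "B _"] cov_W_B)
  then show ?thesis by (simp add: L_\<psi>[OF s])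
qed

lemma cov_diff:
  assumes "\<And>k. (\<lambda>\<omega>. U \<omega> $ k) \<in> gaussian_space" "\<And>k. (\<lambda>\<omega>. U' \<omega> $ k) \<in> gaussian_space"
    "\<And>k. (\<lambda>\<omega>. V \<omega> $ k) \<in> gaussian_space"
  shows "cov (\<lambda>\<omega>. U \<omega> - U' \<omega>) V = cov U V - cov U' V"
  using assms by (simp add: cov_def vec_eq_iff gaussian_space_expectation_diff)

lemma W_increment_gaussian_space:
  assumes "s \<in> {0..T}" "t \<in> {0..T}"
  shows "(\<lambda>\<omega>. (W t \<omega> - W s \<omega>) $ k) \<in> gaussian_space"
  using gaussian_space_diff[OF W_gaussian_space[OF assms(2)] W_gaussian_space[OF assms(1)]] by simp

lemma cov_W_increment:
  assumes "0 \<le> s" "s \<le> t" "t \<le> T"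
  shows "cov (\<lambda>\<omega>. W t \<omega> - W s \<omega>) (\<lambda>\<omega>. W t \<omega> - W s \<omega>) = (t - s) *\<^sub>R mat 1"
proof -
  have t: "t \<in> {0..T}" and s: "s \<in> {0..T}" using assms by auto
  note gs = W_gaussian_space[OF t] W_gaussian_space[OF s] W_increment_gaussian_space[OF s t]
  have "cov (W r) (\<lambda>\<omega>. W t \<omega> - W s \<omega>) = transpose (cov (W t) (W r)) - transpose (cov (W s) (W r))"
    if "r \<in> {s, t}" for r
    using that gs by (subst cov_transpose) (auto simp: cov_diff transpose_diff)
  then have "cov (W t) (\<lambda>\<omega>. W t \<omega> - W s \<omega>) = cov (W t) (W t) - cov (W s) (W t)"
     "cov (W s) (\<lambda>\<omega>. W t \<omega> - W s \<omega>) = cov (W s) (W t) - cov (W s) (W s)"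
    using assms cov_transpose[of "W t" "W s"]
    by (simp_all add: cov_W_W transpose_scaleR transpose_mat transpose_diff)
  then show ?thesis
    using assms gs by (subst cov_diff) (auto simp: cov_W_W scaleR_left_diff_distrib)
qed

lemma space_enlarged: "space (enlarged_filtration M X B t) = space M"
  unfolding enlarged_filtration_def by (simp add: space_measure_of_conv)

lemma sets_enlarged:
  "sets (enlarged_filtration M X B t) = sigma_sets (space M)
    ({X -` A \<inter> space M | A. A \<in> sets borel} \<union> (\<Union>s\<in>{0..t}. {B s -` A \<inter> space M | A. A \<in> sets borel}))"
  unfolding enlarged_filtration_def by (rule sets_measure_of) auto

lemma enlarged_subset:
  assumes "space N = space M" "X \<in> borel_measurable N" "\<And>s. s \<in> {0..t} \<Longrightarrow> B s \<in> borel_measurable N"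
  shows "sets (enlarged_filtration M X B t) \<subseteq> sets N"
proof -
  have "{X -` A \<inter> space M | A. A \<in> sets borel} \<union>
      (\<Union>s\<in>{0..t}. {B s -` A \<inter> space M | A. A \<in> sets borel}) \<subseteq> sets N"
    using measurable_sets[OF assms(2)] measurable_sets[OF assms(3)] unfolding assms(1) by blast
  from sets.sigma_sets_subset[OF this] show ?thesis
    by (simp only: sets_enlarged assms(1))
qed

lemma enlarged_sub_M: "t \<le> T \<Longrightarrow> sets (enlarged_filtration M X B t) \<subseteq> sets M"
  by (rule enlarged_subset) (auto intro: B_measurable)

lemma X_enlarged: "X \<in> borel_measurable (enlarged_filtration M X B t)"
  by (rule measurableI) (auto simp: sets_enlarged space_enlarged)

lemma B_enlarged: "s \<in> {0..t} \<Longrightarrow> B s \<in> borel_measurable (enlarged_filtration M X B t)"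
  by (rule measurableI) (auto simp: sets_enlarged space_enlarged intro!: sigma_sets.Basic bexI[of _ s])

lemma space_G: "space (G t) = space M"
  unfolding augmented_def by (simp add: space_measure_of_conv)

lemma sets_G:
  assumes "t \<le> T"
  shows "sets (G t) = sigma_sets (space M) (sets (enlarged_filtration M X B t) \<union> null_sets M)"
  unfolding augmented_def
  using enlarged_sub_M[OF assms] sets.space_closed[of M] by (intro sets_measure_of) (auto dest: null_setsD2)

lemma G_sub_M:
  assumes "t \<le> T"
  shows "sets (G t) \<subseteq> sets M"
  unfolding sets_G[OF assms] using enlarged_sub_M[OF assms] by (intro sets.sigma_sets_subset) auto

lemma null_sets_G: "t \<le> T \<Longrightarrow> null_sets M \<subseteq> sets (G t)"
  by (auto simp: sets_G)

lemma enlarged_measurable_G: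
  assumes "t \<le> T" "f \<in> borel_measurable (enlarged_filtration M X B t)"
  shows "f \<in> borel_measurable (G t)"
  using measurable_sets[OF assms(2)] assms(1)
  by (intro measurableI) (auto simp: sets_G space_G space_enlarged)

text \<open>The drift is an almost sure limit of adapted sums, and the coordinate formula for W
  holds almost surely; the null sets in the augmented filtration absorb both exceptions.\<close>

lemma W_measurable:
  assumes t: "t \<in> {0..T}"
  shows "W t \<in> borel_measurable (G t)"
proof (rule borel_measurable_vecI)
  fix k
  have G: "space (G t) = space M" "sets (G t) \<subseteq> sets M" "null_sets M \<subseteq> sets (G t)"
    using t space_G null_sets_G G_sub_M by simp_all
  have [measurable]: "X \<in> borel_measurable (G t)"
    using t by (intro enlarged_measurable_G X_enlarged) auto
  have B_G: "B u \<in> borel_measurable (G t)" if "u \<in> {0..t}" for u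
    using t that by (intro enlarged_measurable_G B_enlarged) auto
  have [measurable]: "B t \<in> borel_measurable (G t)" using t by (intro B_G) auto
  have [measurable]: "(\<lambda>\<omega>. integral {0..t} (\<lambda>u. (kernel t u *v B u \<omega>) $ k)) \<in> borel_measurable (G t)"
  proof (rule measurable_integral_augmented[OF complete G])
    fix u assume "u \<in> {0..t}"
    note [measurable] = B_G[OF this]
    show "(\<lambda>\<omega>. (kernel t u *v B u \<omega>) $ k) \<in> borel_measurable (G t)"
      unfolding matrix_vector_mult_def by simp
  qed (use t drift_comp_continuous in auto)
  show "(\<lambda>\<omega>. W t \<omega> $ k) \<in> borel_measurable (G t)"
    by (rule measurable_AE_eq_augmented[OF complete G _ W_comp[OF t]]) measurable
qed

text \<open>The integrand depends on \<open>t\<close> as well as the upper limit does. Separating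
  the kernel into \<open>g t\<close> times one integral and a second integral leaves integrands free
  of \<open>t\<close>, and indefinite integrals are continuous.\<close>

lemma W_continuous: "AE \<omega> in M. continuous_on {0..T} (\<lambda>t. W t \<omega>)"
  using B_continuous
proof eventually_elim
  case (elim \<omega>)
  let ?p = "\<lambda>u. transpose (\<rho>'' u) *v B u \<omega>"
  \<comment> \<open>This is the negative of the theorem's \<open>q\<close> applied to B, hence the
    minus sign in front of its integral.\<close>
  let ?q = "\<lambda>u. (g u ** transpose (\<rho>'' u) + g' u ** transpose (\<rho>' u)) *v B u \<omega>"
  note mv = bounded_bilinear.continuous_on[OF bounded_bilinear_matrix_vector_mult]
  have p: "continuous_on {0..T} ?p" and q: "continuous_on {0..T} ?q"
    by (intro mv continuous_intros elim \<rho>''_cont g_cont g'\<rho>'_cont)+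
  have eq: "W t \<omega> = B t \<omega> - (g t *v integral {0..t} ?p - integral {0..t} ?q) - g t *v X \<omega>"
    if t: "t \<in> {0..T}" for t
  proof -
    have sub: "{0..t} \<subseteq> {0..T}" using t by auto
    have ip: "?p integrable_on {0..t}" and iq: "?q integrable_on {0..t}"
      by (intro integrable_continuous_real continuous_on_subset[OF p sub] continuous_on_subset[OF q sub])+
    have "integral {0..t} (\<lambda>u. kernel t u *v B u \<omega>) = integral {0..t} (\<lambda>u. g t *v ?p u - ?q u)"
      by (intro integral_cong) (simp add: kernel_def matrix_mult_diff_left matrix_vector_mul_assoc
        matrix_vector_mult_diff_rdistrib matrix_vector_mult_add_rdistrib
        del: transpose_matrix_vector)
    also have "\<dots> = integral {0..t} (\<lambda>u. g t *v ?p u) - integral {0..t} ?q"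
      using integrable_linear[OF ip matrix_vector_mul_bounded_linear[of "g t"]] iq
      by (intro integral_diff) (auto simp: o_def)
    also have "integral {0..t} (\<lambda>u. g t *v ?p u) = g t *v integral {0..t} ?p"
      using integral_linear[OF ip matrix_vector_mul_bounded_linear[of "g t"]] by (simp add: o_def)
    finally show ?thesis by (simp add: W_def)
  qed
  have cont: "continuous_on {0..T} (\<lambda>t. B t \<omega> - (g t *v integral {0..t} ?p - integral {0..t} ?q) - g t *v X \<omega>)"
    by (intro continuous_intros mv elim g_cont indefinite_integral_continuous_1
        integrable_continuous_real p q)
  show ?case by (rule continuous_on_eq[OF cont]) (rule eq[symmetric])
qed

lemma W_0: "AE \<omega> in M. W 0 \<omega> = 0"
  using B_0 by eventually_elim (simp add: W_def g_0)

text \<open>Vector-valued generators are broken into scalar coordinates, which is the form in which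
  the independence lemma treats X and B together despite their different dimensions.\<close>

lemma G_subset_cylinders:
  assumes "t \<le> T"
  shows "sets (G t) \<subseteq> sigma_sets (space M) (cylinders (indices t) (component_family X B) \<union> null_sets M)"
proof -
  let ?E = "cylinders (indices t) (component_family X B) \<union> null_sets M"
  let ?N = "sigma (space M) ?E"
  have E: "?E \<subseteq> Pow (space M)"
    using sets.space_closed[of M] by (auto simp: cylinders_def dest: null_setsD2)
  have sp: "space ?N = space M" by (simp add: space_measure_of_conv)
  have se: "sets ?N = sigma_sets (space M) ?E" using E by (rule sets_measure_of)
  have fam: "component_family X B i \<in> borel_measurable ?N" if "i \<in> indices t" for i
    using vimage_in_cylinders[OF that] by (intro measurableI) (auto simp: se sp)
  have "sets (enlarged_filtration M X B t) \<subseteq> sets ?N"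
  proof (rule enlarged_subset[OF sp])
    show "X \<in> borel_measurable ?N"
      by (rule borel_measurable_vecI) (unfold X_eq, rule fam, auto)
    show "B s \<in> borel_measurable ?N" if "s \<in> {0..t}" for s
      by (rule borel_measurable_vecI) (unfold B_eq, rule fam, use that in auto)
  qed
  moreover have "null_sets M \<subseteq> sets ?N" by (auto simp: se)
  ultimately have "sets (enlarged_filtration M X B t) \<union> null_sets M \<subseteq> sets ?N" by simp
  from sets.sigma_sets_subset[OF this] show ?thesis
    by (simp only: sets_G[OF assms] se sp)
qed

lemma W_increment_indep:
  assumes "0 \<le> s" "s \<le> t" "t \<le> T"
  shows "indep_set (sets (G s)) {(\<lambda>\<omega>. W t \<omega> - W s \<omega>) -` A \<inter> space M | A. A \<in> sets borel}"
proof -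
  have t: "t \<in> {0..T}" and s: "s \<in> {0..T}" using assms by auto
  let ?D = "\<lambda>k \<omega>. (W t \<omega> - W s \<omega>) $ k"
  note gs = W_gaussian_space[OF t] W_gaussian_space[OF s]
  have cov_X: "cov (\<lambda>\<omega>. W t \<omega> - W s \<omega>) X = 0"
    using cov_diff[OF gs X_gaussian_space] t s by (simp add: cov_W_X)
  \<comment> \<open>For \<open>r \<le> s\<close> both covariances equal \<open>\<psi> r\<close>,
    independently of the later time, and cancel.\<close>
  have cov_B: "cov (\<lambda>\<omega>. W t \<omega> - W s \<omega>) (B r) = 0" if "r \<in> {0..s}" for r
    using cov_diff[OF gs B_gaussian_space[of r]] that assms by (simp add: cov_W_B)
  have "indep_set (sigma_sets (space M) (cylinders (indices s) (component_family X B) \<union> null_sets M))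
     (sigma_sets (space M) (cylinders UNIV ?D))"
  proof (rule gaussian_space_indep_set)
    show "component_family X B j \<in> gaussian_space" if "j \<in> indices s" for j
      using that s by (intro gaussian_space_family) auto
    show "?D k \<in> gaussian_space" for k by (rule W_increment_gaussian_space[OF s t])
    show "expectation (\<lambda>\<omega>. ?D k \<omega> * component_family X B j \<omega>) = 0" if "j \<in> indices s" for j k
      using that cov_X cov_B by (auto simp: component_family_def cov_def vec_eq_iff)
  qed
  moreover have "{(\<lambda>\<omega>. W t \<omega> - W s \<omega>) -` A \<inter> space M | A. A \<in> sets borel} \<subseteq>
     sigma_sets (space M) (cylinders UNIV ?D)"
    by (rule vec_vimages_subset_cylinders)
  moreover note G_subset_cylinders[of s] assms
  ultimately show ?thesis unfolding indep_sets2_eq by (meson order_trans subsetD)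
qed

lemma W_increment_gaussian:
  assumes "0 \<le> s" "s \<le> t" "t \<le> T"
  shows "centered_gaussian_vector M (\<lambda>\<omega>. W t \<omega> - W s \<omega>) ((t - s) *\<^sub>R mat 1)"
proof -
  have t: "t \<in> {0..T}" and s: "s \<in> {0..T}" using assms by auto
  note D = W_increment_gaussian_space[OF s t]
  have mean: "expectation (\<lambda>\<omega>. (W t \<omega> - W s \<omega>) $ k) = 0" for k
    using D by (rule gaussian_space_moments(2))
  have "gaussian_rv M (\<lambda>\<omega>. \<Sum>j\<in>J. c j * (W t \<omega> - W s \<omega>) $ j)" if "finite J" for J c
    using gaussian_space_normal[OF gaussian_space_sum[OF that gaussian_space_scale[OF D]],
        of c "\<lambda>j. j"]
    unfolding centered_normal_def gaussian_rv_def by blast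
  moreover have "covariance_matrix M (\<lambda>\<omega>. W t \<omega> - W s \<omega>) = (t - s) *\<^sub>R mat 1"
    using cov_W_increment[OF assms] unfolding covariance_matrix_def mean cov_def by simp
  ultimately show ?thesis
    using mean by (simp add: centered_gaussian_vector_def gaussian_vector_def jointly_gaussian_def)
qed

lemma brownian_motion_W: "brownian_motion_wrt M T G W"
  unfolding brownian_motion_wrt_def
proof (intro conjI ballI allI impI)
  show "subalgebra M (G t)" if "t \<in> {0..T}" for t
    using that G_sub_M[of t] by (auto simp: subalgebra_def space_G)
  show "sets (G s) \<subseteq> sets (G t)" if "0 \<le> s \<and> s \<le> t \<and> t \<le> T" for s t
  proof -
    have "sets (enlarged_filtration M X B s) \<subseteq> sets (enlarged_filtration M X B t)"
      using that by (intro enlarged_subset X_enlarged B_enlarged space_enlarged) auto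
    then have "sets (enlarged_filtration M X B s) \<union> null_sets M \<subseteq>
        sets (enlarged_filtration M X B t) \<union> null_sets M" by auto
    then show ?thesis
      using that by (simp add: sets_G sigma_sets_mono')
  qed
qed (use W_measurable W_0 W_continuous W_increment_indep W_increment_gaussian in auto)

end

section \<open>Back to the kernel of the statement\<close>

lemma brownian_motion_wrt_cong:
  assumes "\<And>t. t \<in> {0..T} \<Longrightarrow> V t = V' t" "0 \<le> T"
  shows "brownian_motion_wrt M T F V \<longleftrightarrow> brownian_motion_wrt M T F V'"
proof -
  have "continuous_on {0..T} (\<lambda>t. V t \<omega>) \<longleftrightarrow> continuous_on {0..T} (\<lambda>t. V' t \<omega>)" for \<omega>
    using assms(1) by (intro continuous_on_cong) auto
  then show ?thesis
    unfolding brownian_motion_wrt_def using assms by (intro conj_cong ball_cong all_cong imp_cong) auto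
qed

theorem lemma2p1:
  fixes M :: "'w measure"
    and T :: real
    and B :: "real \<Rightarrow> 'w \<Rightarrow> real ^ 'n"
    and X :: "'w \<Rightarrow> real ^ 'm"
    and \<Sigma> :: "real ^ 'm ^ 'm"
    and \<rho> \<rho>' \<rho>'' g g' :: "real \<Rightarrow> real ^ 'm ^ 'n"
    and p :: "real \<Rightarrow> real ^ 'n ^ 'm"
    and q :: "real \<Rightarrow> real ^ 'n ^ 'n"
    and lam :: "real \<Rightarrow> real \<Rightarrow> real ^ 'n ^ 'n"
  assumes "prob_space M" and "complete_measure M"
    and "T > 0"
    and "standard_brownian_motion M T B"
    and "centered_gaussian_vector M X \<Sigma>"
    and "jointly_gaussian M (UNIV <+> ({0..T} \<times> UNIV)) (component_family X B)"
    and "\<And>t. t \<in> {0..T} \<Longrightarrow> (LINT \<omega>|M. outer_product (B t \<omega>) (X \<omega>)) = \<rho> t"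
    and "\<And>t. t \<in> {0..T} \<Longrightarrow> (\<rho> has_vector_derivative \<rho>' t) (at t within {0..T})"
    and "\<And>t. t \<in> {0..T} \<Longrightarrow> (\<rho>' has_vector_derivative \<rho>'' t) (at t within {0..T})"
    and "continuous_on {0..T} \<rho>''"
    and "continuous_on {0..T} g"
    and "\<And>t. t \<in> {0..T} \<Longrightarrow> (g has_vector_derivative g' t) (at t within {0..T})"
    and "\<And>t. t \<in> {0..T} \<Longrightarrow>
           g' t ** (\<Sigma> - integral {0..t} (\<lambda>u. transpose (\<rho>' u) ** \<rho>' u)) = \<rho>' t"
    and "g 0 = 0"
    and "continuous_on {0..T} p"
    and "\<And>s. s \<in> {0..T} \<Longrightarrow> p s = transpose (\<rho>'' s)"
    and "continuous_on {0..T} q"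
    and "\<And>s. s \<in> {0..T} \<Longrightarrow>
           q s = - (g s ** transpose (\<rho>'' s)) - g' s ** transpose (\<rho>' s)"
    and "\<And>t s. 0 \<le> s \<Longrightarrow> s \<le> t \<Longrightarrow> t \<le> T \<Longrightarrow> lam t s = g t ** p s + q s"
  shows "brownian_motion_wrt M T
           (augmented M (enlarged_filtration M X B))
           (\<lambda>t \<omega>. B t \<omega> - integral {0..t} (\<lambda>u. lam t u *v B u \<omega>) - g t *v X \<omega>)"
proof -
  interpret gaussian_enlargement M T B X \<Sigma> \<rho>
    using assms(1-7) by (intro gaussian_enlargement.intro gaussian_enlargement_axioms.intro)
  \<comment> \<open>The formula for \<open>q\<close> solved for the product of g' with the transpose
    of \<rho>': its continuity comes from that of \<open>q\<close>, \<open>g\<close> and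
    \<rho>''.\<close>
  have "continuous_on {0..T} (\<lambda>s. - (q s + g s ** transpose (\<rho>'' s)))"
    by (intro continuous_intros assms)
  then have "continuous_on {0..T} (\<lambda>s. g' s ** transpose (\<rho>' s))"
    by (rule continuous_on_eq) (simp add: assms)
  then interpret drift_kernel T \<Sigma> \<rho> \<rho>' \<rho>'' g g'
    using assms \<rho>_zero \<Sigma>_symmetric by unfold_locales
  interpret gaussian_enlargement_kernel M T B X \<Sigma> \<rho> \<rho>' \<rho>'' g g' ..
  \<comment> \<open>The two kernels agree only on the triangle, which covers every time in
    \<open>{0..T}\<close>; the definition of Brownian motion constrains no other values.\<close>
  have lam: "lam t u = kernel t u" if "0 \<le> u" "u \<le> t" "t \<le> T" for t u
    using that by (simp add: assms kernel_def matrix_mult_diff_left)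
  have "W t \<omega> = B t \<omega> - integral {0..t} (\<lambda>u. lam t u *v B u \<omega>) - g t *v X \<omega>" if "t \<in> {0..T}" for t \<omega>
    using that by (auto simp: W_def lam intro!: integral_cong)
  then have eq: "(\<lambda>\<omega>. B t \<omega> - integral {0..t} (\<lambda>u. lam t u *v B u \<omega>) - g t *v X \<omega>) = W t"
    if "t \<in> {0..T}" for t using that by (simp add: fun_eq_iff)
  show ?thesis
    using brownian_motion_W T_pos by (subst brownian_motion_wrt_cong[OF eq]) auto
qed

end
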